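(* Let $G=(V,E)$ be a connected graph in which every vertex has finite degree, let $(w_t)_{t\ge 0}$ be a simple random walk on $G$ started at an arbitrary fixed vertex, and let $PATH$ be the random subgraph of $G$ consisting of all vertices visited and all edges crossed by the walk. Then almost surely $PATH$ is a recurrent graph.
   Context: Graphs may be finite or infinite; parallel edges are allowed. A simple random walk (SRW) on a graph with finite degrees is the Markov chain which, at each step, from its current vertex $v$ chooses uniformly at random one of the $d_v$ edges meeting $v$ ($d_v$ is the number of edges meeting $v$) and crosses it to its other endpoint. (In a graph without parallel edges, the transition probability from $v$ to each neighbour is $1/d_v$.) We assume $d_v\ge 1$ so that the walk is defined. A connected graph with finite degrees is called recurrent if almost surely the SRW on it visits any fixed vertex infinitely often, and transient otherwise. Note that $PATH$ is a connected graph with finite degrees; the assertion is that for almost every realization of the walk on $G$, the (now fixed) graph $PATH$ is recurrent for the SRW on $PATH$ itself. *)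

theory Defs
  imports "HOL-Probability.Probability"
begin

section \<open>Multigraphs\<close>

text \<open>
  Undirected graphs, finite or infinite, with parallel edges but without loops: an edge is an
  abstract object with a two-element set of endpoints, and distinct edges may have the same
  endpoints.
\<close>

record ('v, 'e) multigraph =
  verts :: "'v set"
  edges :: "'e set"
  ends :: "'e \<Rightarrow> 'v set"

definition wf_multigraph :: "('v, 'e) multigraph \<Rightarrow> bool" where
  "wf_multigraph G \<longleftrightarrow> (\<forall>e\<in>edges G. ends G e \<subseteq> verts G \<and> card (ends G e) = 2)"

definition incident :: "('v, 'e) multigraph \<Rightarrow> 'v \<Rightarrow> 'e set" where
  "incident G v = {e \<in> edges G. v \<in> ends G e}"

definition vdegree :: "('v, 'e) multigraph \<Rightarrow> 'v \<Rightarrow> nat" where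
  "vdegree G v = card (incident G v)"

definition connected_multigraph :: "('v, 'e) multigraph \<Rightarrow> bool" where
  "connected_multigraph G \<longleftrightarrow>
     verts G \<noteq> {} \<and>
     (\<forall>u\<in>verts G. \<forall>v\<in>verts G. (u, v) \<in> {(x, y). \<exists>e\<in>edges G. ends G e = {x, y}}\<^sup>*)"

text \<open>The standing assumptions under which the simple random walk and recurrence are considered.\<close>

definition walkable :: "('v, 'e) multigraph \<Rightarrow> bool" where
  "walkable G \<longleftrightarrow>
     wf_multigraph G \<and> connected_multigraph G \<and>
     (\<forall>v\<in>verts G. finite (incident G v) \<and> 1 \<le> vdegree G v)"


section \<open>Simple random walk\<close>

text \<open>
  Because of parallel edges, the positions do not determine which edges are crossed, so the walk
  is a pair of processes: \<open>W t\<close> is the position at time \<open>t\<close>, and \<open>X t\<close> is the edge crossed between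
  times \<open>t\<close> and \<open>t + 1\<close>. The last clause says that, conditionally on any possible history
  \<open>v 0, e 0, v 1, \<dots>, e (t - 1), v t\<close>, the edge \<open>X t\<close> is uniform among the edges meeting \<open>v t\<close>.
\<close>

definition simple_random_walk ::
  "('v, 'e) multigraph \<Rightarrow> 'v \<Rightarrow> 'w measure \<Rightarrow> (nat \<Rightarrow> 'w \<Rightarrow> 'v) \<Rightarrow> (nat \<Rightarrow> 'w \<Rightarrow> 'e) \<Rightarrow> bool" where
  "simple_random_walk G x\<^sub>0 M W X \<longleftrightarrow>
     prob_space M \<and>
     (\<forall>t. W t \<in> measurable M (count_space (verts G))) \<and>
     (\<forall>t. X t \<in> measurable M (count_space (edges G))) \<and>
     (AE \<omega> in M. W 0 \<omega> = x\<^sub>0) \<and>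
     (\<forall>t. AE \<omega> in M. ends G (X t \<omega>) = {W t \<omega>, W (Suc t) \<omega>}) \<and>
     (\<forall>t v e. \<P>(\<omega> in M. (\<forall>s<t. W s \<omega> = v s \<and> X s \<omega> = e s) \<and> W t \<omega> = v t) > 0 \<longrightarrow>
        (\<forall>a\<in>incident G (v t).
           \<P>(\<omega> in M. X t \<omega> = a \<bar> (\<forall>s<t. W s \<omega> = v s \<and> X s \<omega> = e s) \<and> W t \<omega> = v t)
             = 1 / vdegree G (v t)))"


section \<open>Recurrence\<close>

text \<open>
  A definition cannot quantify over all sample space types, so the walks are taken on probability
  spaces over the type of trajectories. This loses nothing, since the property only depends on the
  law of the walk; walks on such a space exist by the lemma \<open>simple_random_walk_exists\<close> below, so
  the quantification is not vacuous.
\<close>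

definition recurrent :: "('v, 'e) multigraph \<Rightarrow> bool" where
  "recurrent G \<longleftrightarrow>
     walkable G \<and>
     (\<forall>x\<^sub>0\<in>verts G. \<forall>(M :: (nat \<Rightarrow> 'v \<times> 'e) measure) W X.
        simple_random_walk G x\<^sub>0 M W X \<longrightarrow>
        (\<forall>x\<in>verts G. AE \<omega> in M. \<exists>\<^sub>\<infinity>t. W t \<omega> = x))"


section \<open>The trace of a walk\<close>

definition PATH ::
  "('v, 'e) multigraph \<Rightarrow> (nat \<Rightarrow> 'w \<Rightarrow> 'v) \<Rightarrow> (nat \<Rightarrow> 'w \<Rightarrow> 'e) \<Rightarrow> 'w \<Rightarrow> ('v, 'e) multigraph" where
  "PATH G W X \<omega> =
     \<lparr> verts = range (\<lambda>t. W t \<omega>), edges = range (\<lambda>t. X t \<omega>), ends = ends G \<rparr>"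


section \<open>Existence of the simple random walk\<close>

text \<open>
  The walk is driven by independent random edges \<open>\<omega> (t, v)\<close>, uniform among the edges
  meeting \<open>v\<close>; the walk follows \<open>\<omega> (t, v)\<close> if it is at \<open>v\<close> at time \<open>t\<close>.
\<close>

definition other_end :: "('v, 'e) multigraph \<Rightarrow> 'v \<Rightarrow> 'e \<Rightarrow> 'v" where
  "other_end G v e = (SOME u. ends G e = {v, u})"

definition pick :: "('v, 'e) multigraph \<Rightarrow> 'v \<Rightarrow> 'e \<Rightarrow> 'e" where
  "pick G v e = (if e \<in> incident G v then e else (SOME e'. e' \<in> incident G v))"

primrec pos :: "('v, 'e) multigraph \<Rightarrow> 'v \<Rightarrow> nat \<Rightarrow> (nat \<times> 'v \<Rightarrow> 'e) \<Rightarrow> 'v" where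
  "pos G x\<^sub>0 0 \<omega> = x\<^sub>0"
| "pos G x\<^sub>0 (Suc t) \<omega> =
     other_end G (pos G x\<^sub>0 t \<omega>) (pick G (pos G x\<^sub>0 t \<omega>) (\<omega> (t, pos G x\<^sub>0 t \<omega>)))"

definition crossed :: "('v, 'e) multigraph \<Rightarrow> 'v \<Rightarrow> nat \<Rightarrow> (nat \<times> 'v \<Rightarrow> 'e) \<Rightarrow> 'e" where
  "crossed G x\<^sub>0 t \<omega> = pick G (pos G x\<^sub>0 t \<omega>) (\<omega> (t, pos G x\<^sub>0 t \<omega>))"

definition driving :: "('v, 'e) multigraph \<Rightarrow> (nat \<times> 'v \<Rightarrow> 'e) measure" where
  "driving G = PiM UNIV (\<lambda>(t, v). measure_pmf (pmf_of_set (incident G v)))"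

context
  fixes G :: "('v, 'e) multigraph" and x\<^sub>0 :: 'v
  assumes G: "walkable G" and x\<^sub>0: "x\<^sub>0 \<in> verts G"
begin

lemma incident_fin: "v \<in> verts G \<Longrightarrow> finite (incident G v)"
  and incident_ne: "v \<in> verts G \<Longrightarrow> incident G v \<noteq> {}"
  using G by (auto simp: walkable_def vdegree_def)

lemma pick_in: "v \<in> verts G \<Longrightarrow> pick G v e \<in> incident G v"
  using incident_ne[of v] by (auto simp: pick_def some_in_eq)

lemma ends_other_end:
  assumes "e \<in> incident G v" shows "ends G e = {v, other_end G v e}"
proof -
  from assms G have "card (ends G e) = 2" "v \<in> ends G e"
    by (auto simp: walkable_def wf_multigraph_def incident_def)
  then have "\<exists>u. ends G e = {v, u}" by (auto simp: card_2_iff)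
  then show ?thesis unfolding other_end_def by (rule someI_ex)
qed

lemma other_end_in: "e \<in> incident G v \<Longrightarrow> other_end G v e \<in> verts G"
  using ends_other_end[of e v] G by (auto simp: walkable_def wf_multigraph_def incident_def)

lemma pos_in: "pos G x\<^sub>0 t \<omega> \<in> verts G"
  by (induction t) (auto simp: x\<^sub>0 intro!: other_end_in pick_in)

lemma crossed_in: "crossed G x\<^sub>0 t \<omega> \<in> incident G (pos G x\<^sub>0 t \<omega>)"
  by (auto simp: crossed_def intro!: pick_in pos_in)

lemma driving_component:
  "(\<And>e. f e \<in> A) \<Longrightarrow> (\<lambda>\<omega>. f (\<omega> (t, v))) \<in> measurable (driving G) (count_space A)"
proof -
  assume "\<And>e. f e \<in> A"
  then have "f \<in> measurable (measure_pmf (pmf_of_set (incident G v))) (count_space A)"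
    by auto
  moreover have "(\<lambda>\<omega>. \<omega> (t, v)) \<in> measurable (driving G) (measure_pmf (pmf_of_set (incident G v)))"
    unfolding driving_def
    using measurable_component_singleton[of "(t, v)" UNIV
        "\<lambda>(t, v). measure_pmf (pmf_of_set (incident G v))"] by simp
  ultimately show ?thesis by (rule measurable_compose_rev)
qed

lemma pos_measurable_finite:
  "\<exists>R. finite R \<and> R \<subseteq> verts G \<and> pos G x\<^sub>0 t \<in> measurable (driving G) (count_space R)"
proof (induction t)
  case 0
  have "pos G x\<^sub>0 0 = (\<lambda>_. x\<^sub>0)" by auto
  then show ?case using x\<^sub>0 by (intro exI[of _ "{x\<^sub>0}"]) auto
next
  case (Suc t)
  then obtain R where R: "finite R" "R \<subseteq> verts G"
    "pos G x\<^sub>0 t \<in> measurable (driving G) (count_space R)" by blast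
  define R' where "R' = (\<Union>w\<in>R. other_end G w ` incident G w)"
  have "(\<lambda>\<omega>. (\<lambda>w \<omega>. other_end G w (pick G w (\<omega> (t, w)))) (pos G x\<^sub>0 t \<omega>) \<omega>)
      \<in> measurable (driving G) (count_space R')"
  proof (rule measurable_compose_countable'[OF _ R(3) countable_finite[OF R(1)]])
    fix w assume "w \<in> R"
    then have "other_end G w (pick G w e) \<in> R'" for e
      using R(2) pick_in[of w e] unfolding R'_def by blast
    then show "(\<lambda>\<omega>. other_end G w (pick G w (\<omega> (t, w)))) \<in> measurable (driving G) (count_space R')"
      by (rule driving_component)
  qed
  moreover have "finite R'" "R' \<subseteq> verts G"
    using R incident_fin other_end_in by (auto simp: R'_def)
  ultimately show ?case by (intro exI[of _ R']) (simp add: pos.simps[abs_def])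
qed

lemma pos_measurable: "pos G x\<^sub>0 t \<in> measurable (driving G) (count_space (verts G))"
proof -
  obtain R where R: "R \<subseteq> verts G" "pos G x\<^sub>0 t \<in> measurable (driving G) (count_space R)"
    using pos_measurable_finite by blast
  have "(\<lambda>x. x) \<in> measurable (count_space R) (count_space (verts G))" using R by auto
  from measurable_compose[OF R(2) this] show ?thesis by simp
qed

lemma crossed_measurable: "crossed G x\<^sub>0 t \<in> measurable (driving G) (count_space (edges G))"
proof -
  obtain R where R: "finite R" "R \<subseteq> verts G"
    "pos G x\<^sub>0 t \<in> measurable (driving G) (count_space R)"
    using pos_measurable_finite by blast
  have "(\<lambda>\<omega>. (\<lambda>w \<omega>. pick G w (\<omega> (t, w))) (pos G x\<^sub>0 t \<omega>) \<omega>)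
      \<in> measurable (driving G) (count_space (edges G))"
  proof (rule measurable_compose_countable'[OF _ R(3) countable_finite[OF R(1)]])
    fix w assume "w \<in> R"
    then have "pick G w e \<in> edges G" for e
      using R(2) pick_in[of w e] by (auto simp: incident_def)
    then show "(\<lambda>\<omega>. pick G w (\<omega> (t, w))) \<in> measurable (driving G) (count_space (edges G))"
      by (rule driving_component)
  qed
  then show ?thesis by (simp add: crossed_def[abs_def])
qed

lemma prob_space_driving: "prob_space (driving G)"
  unfolding driving_def
  by (intro prob_space_PiM) (auto simp: measure_pmf.prob_space_axioms)

lemma driving_cylinder:
  "measure (driving G) {\<omega>. \<forall>s<t. pick G (v s) (\<omega> (s, v s)) = e s}
     = (\<Prod>s<(t::nat). measure_pmf.prob (pmf_of_set (incident G (v s))) {x. pick G (v s) x = e s})"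
proof -
  interpret P: product_prob_space "\<lambda>(t::nat, v). measure_pmf (pmf_of_set (incident G v))" UNIV
    by (intro product_prob_spaceI) (auto simp: measure_pmf.prob_space_axioms)
  define J where "J = (\<lambda>s. (s, v s)) ` {..<t}"
  define Y where "Y = (\<lambda>(s, w). {x. pick G w x = e s})"
  have "emeasure (driving G) {\<omega> \<in> space (driving G). \<forall>i\<in>J. \<omega> i \<in> Y i}
      = (\<Prod>i\<in>J. emeasure ((\<lambda>(t, v). measure_pmf (pmf_of_set (incident G v))) i) (Y i))"
    unfolding driving_def by (rule P.emeasure_PiM_Collect) (auto simp: J_def)
  also have "{\<omega> \<in> space (driving G). \<forall>i\<in>J. \<omega> i \<in> Y i}
      = {\<omega>. \<forall>s<t. pick G (v s) (\<omega> (s, v s)) = e s}"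
    by (auto simp: J_def Y_def driving_def space_PiM)
  also have "(\<Prod>i\<in>J. emeasure ((\<lambda>(t, v). measure_pmf (pmf_of_set (incident G v))) i) (Y i))
      = (\<Prod>s<t. emeasure (measure_pmf (pmf_of_set (incident G (v s)))) {x. pick G (v s) x = e s})"
    unfolding J_def Y_def by (subst prod.reindex) (auto simp: inj_on_def)
  finally have "emeasure (driving G) {\<omega>. \<forall>s<t. pick G (v s) (\<omega> (s, v s)) = e s}
      = ennreal (\<Prod>s<t. measure_pmf.prob (pmf_of_set (incident G (v s))) {x. pick G (v s) x = e s})"
    by (simp add: measure_pmf.emeasure_eq_measure prod_ennreal)
  then show ?thesis by (rule measure_eq_emeasure_eq_ennreal[rotated]) (simp add: prod_nonneg)
qed

lemma pick_uniform:
  assumes "v \<in> verts G" "a \<in> incident G v"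
  shows "measure_pmf.prob (pmf_of_set (incident G v)) {x. pick G v x = a} = 1 / vdegree G v"
proof -
  note fin = incident_fin[OF assms(1)] incident_ne[OF assms(1)]
  have "measure_pmf.prob (pmf_of_set (incident G v)) {x. pick G v x = a}
      = measure_pmf.prob (pmf_of_set (incident G v)) {a}"
    using assms fin
    by (intro measure_pmf.finite_measure_eq_AE) (auto simp: AE_measure_pmf_iff pick_def)
  then show ?thesis using fin assms by (simp add: measure_pmf_single vdegree_def)
qed

lemma driving_step:
  fixes v :: "nat \<Rightarrow> 'v" and e :: "nat \<Rightarrow> 'e"
  assumes a: "a \<in> incident G (v t)"
  defines "H \<equiv> {\<omega>. (\<forall>s<t. pos G x\<^sub>0 s \<omega> = v s \<and> crossed G x\<^sub>0 s \<omega> = e s) \<and> pos G x\<^sub>0 t \<omega> = v t}"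
  shows "measure (driving G) {\<omega>\<in>H. crossed G x\<^sub>0 t \<omega> = a}
    = measure (driving G) H * (1 / vdegree G (v t))"
proof (cases "H = {}")
  case False
  then obtain \<omega>\<^sub>0 where \<omega>\<^sub>0: "\<omega>\<^sub>0 \<in> H" by blast
  have v0: "v 0 = x\<^sub>0" using \<omega>\<^sub>0 by (cases t) (auto simp: H_def split: if_splits)
  have vs: "v (Suc s) = other_end G (v s) (e s)" if "s < t" for s
  proof -
    have "pos G x\<^sub>0 (Suc s) \<omega>\<^sub>0 = v (Suc s)"
      using \<omega>\<^sub>0 that by (cases "Suc s = t") (auto simp: H_def simp del: pos.simps)
    moreover have "pos G x\<^sub>0 (Suc s) \<omega>\<^sub>0 = other_end G (pos G x\<^sub>0 s \<omega>\<^sub>0) (crossed G x\<^sub>0 s \<omega>\<^sub>0)"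
      by (simp add: crossed_def)
    ultimately show ?thesis using \<omega>\<^sub>0 that by (auto simp: H_def simp del: pos.simps)
  qed
  have vt: "v t \<in> verts G" using \<omega>\<^sub>0 pos_in[of t \<omega>\<^sub>0] by (auto simp: H_def)
  have H: "H = {\<omega>. \<forall>s<t. pick G (v s) (\<omega> (s, v s)) = e s}"
  proof (intro set_eqI iffI)
    fix \<omega> assume "\<omega> \<in> H"
    then show "\<omega> \<in> {\<omega>. \<forall>s<t. pick G (v s) (\<omega> (s, v s)) = e s}"
      by (force simp: H_def crossed_def)
  next
    fix \<omega> assume \<omega>: "\<omega> \<in> {\<omega>. \<forall>s<t. pick G (v s) (\<omega> (s, v s)) = e s}"
    have "s \<le> t \<Longrightarrow> pos G x\<^sub>0 s \<omega> = v s" for s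
    proof (induction s)
      case (Suc s) then show ?case using \<omega> vs[of s] by simp
    qed (simp add: v0)
    then show "\<omega> \<in> H" using \<omega> by (auto simp: H_def crossed_def)
  qed
  define e' where "e' = e(t := a)"
  have "{\<omega>\<in>H. crossed G x\<^sub>0 t \<omega> = a} = {\<omega>\<in>H. pick G (v t) (\<omega> (t, v t)) = a}"
    by (auto simp: H_def crossed_def)
  also have "\<dots> = {\<omega>. \<forall>s<Suc t. pick G (v s) (\<omega> (s, v s)) = e' s}"
    unfolding H by (auto simp: e'_def less_Suc_eq)
  also have "measure (driving G) \<dots> = measure (driving G) {\<omega>. \<forall>s<t. pick G (v s) (\<omega> (s, v s)) = e' s}
      * measure_pmf.prob (pmf_of_set (incident G (v t))) {x. pick G (v t) x = e' t}"
    by (simp only: driving_cylinder prod.lessThan_Suc)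
  also have "{\<omega>. \<forall>s<t. pick G (v s) (\<omega> (s, v s)) = e' s} = H"
    unfolding H by (auto simp: e'_def)
  also have "measure_pmf.prob (pmf_of_set (incident G (v t))) {x. pick G (v t) x = e' t}
      = 1 / vdegree G (v t)"
    using pick_uniform[OF vt a] by (simp add: e'_def)
  finally show ?thesis .
qed simp

lemma simple_random_walk_exists:
  "\<exists>(M :: (nat \<Rightarrow> 'v \<times> 'e) measure) W X. simple_random_walk G x\<^sub>0 M W X"
proof -
  let ?D = "driving G"
  define T where "T = (\<lambda>\<omega> t. (pos G x\<^sub>0 t \<omega>, crossed G x\<^sub>0 t \<omega>))"
  define N where "N = restrict_space
    (PiM (UNIV :: nat set) (\<lambda>_. count_space (verts G) \<Otimes>\<^sub>M count_space (edges G))) (range T)"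
  define M where "M = distr ?D N T"
  define W where "W = (\<lambda>t (\<eta> :: nat \<Rightarrow> 'v \<times> 'e). fst (\<eta> t))"
  define X where "X = (\<lambda>t (\<eta> :: nat \<Rightarrow> 'v \<times> 'e). snd (\<eta> t))"
  have spD: "space ?D = UNIV" by (auto simp: driving_def space_PiM)
  have pair: "(\<lambda>\<omega>. (pos G x\<^sub>0 t \<omega>, crossed G x\<^sub>0 t \<omega>))
      \<in> measurable ?D (count_space (verts G) \<Otimes>\<^sub>M count_space (edges G))" for t
    by (rule measurable_Pair[OF pos_measurable crossed_measurable])
  have T: "T \<in> measurable ?D N"
    unfolding N_def
  proof (rule measurable_restrict_space2)
    show "T \<in> measurable ?D (PiM UNIV (\<lambda>_. count_space (verts G) \<Otimes>\<^sub>M count_space (edges G)))"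
      unfolding T_def using measurable_space[OF pair]
      by (intro measurable_PiM_single' pair) auto
  qed simp
  have spN: "space N = range T"
    using measurable_space[OF T] spD by (auto simp: N_def space_restrict_space)
  have WX: "W t \<in> measurable N (count_space (verts G))" "X t \<in> measurable N (count_space (edges G))" for t
    unfolding W_def X_def N_def by (rule measurable_restrict_space1; measurable)+
  have id: "(\<lambda>x. x) \<in> measurable (count_space A) (count_space UNIV)" for A :: "'c set" by simp
  have WX'[measurable]: "W t \<in> measurable N (count_space UNIV)" "X t \<in> measurable N (count_space UNIV)" for t
    using measurable_compose[OF WX(1) id] measurable_compose[OF WX(2) id] by simp_all
  have M: "prob_space M" unfolding M_def by (rule prob_space.prob_space_distr[OF prob_space_driving T])
  have spM: "space M = range T" by (simp add: M_def spN)
  have "simple_random_walk G x\<^sub>0 M W X"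
    unfolding simple_random_walk_def
  proof (intro conjI allI impI ballI)
    show "W t \<in> measurable M (count_space (verts G))" "X t \<in> measurable M (count_space (edges G))" for t
      using WX by (simp_all add: M_def)
    show "AE \<omega> in M. W 0 \<omega> = x\<^sub>0" by (rule AE_I2) (auto simp: spM T_def W_def)
    show "AE \<omega> in M. ends G (X t \<omega>) = {W t \<omega>, W (Suc t) \<omega>}" for t
      using ends_other_end[OF crossed_in]
      by (intro AE_I2) (auto simp: spM T_def W_def X_def crossed_def)
  next
    fix t :: nat and v :: "nat \<Rightarrow> 'v" and e :: "nat \<Rightarrow> 'e" and a
    assume a: "a \<in> incident G (v t)"
    let ?Q = "\<lambda>\<omega>. (\<forall>s<t. W s \<omega> = v s \<and> X s \<omega> = e s) \<and> W t \<omega> = v t"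
    let ?H = "{\<omega>. (\<forall>s<t. pos G x\<^sub>0 s \<omega> = v s \<and> crossed G x\<^sub>0 s \<omega> = e s) \<and> pos G x\<^sub>0 t \<omega> = v t}"
    assume pos: "\<P>(\<omega> in M. ?Q \<omega>) > 0"
    have 1: "\<P>(\<omega> in M. ?Q \<omega>) = measure ?D ?H"
    proof -
      have "{\<omega>\<in>space N. ?Q \<omega>} \<in> sets N" by measurable
      then show ?thesis unfolding M_def
        by (simp add: measure_distr[OF T])
           (rule arg_cong[where f = "measure ?D"], auto simp: spN spD T_def W_def X_def)
    qed
    have 2: "\<P>(\<omega> in M. X t \<omega> = a \<and> ?Q \<omega>) = measure ?D {\<omega>\<in>?H. crossed G x\<^sub>0 t \<omega> = a}"
    proof -
      have "{\<omega>\<in>space N. X t \<omega> = a \<and> ?Q \<omega>} \<in> sets N" by measurable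
      then show ?thesis unfolding M_def
        by (simp add: measure_distr[OF T])
           (rule arg_cong[where f = "measure ?D"], auto simp: spN spD T_def W_def X_def)
    qed
    show "cond_prob M (\<lambda>\<omega>. X t \<omega> = a) ?Q = 1 / vdegree G (v t)"
      using pos unfolding cond_prob_def 1 2 driving_step[of a v t e, OF a] by simp
  qed (fact M)
  then show ?thesis by blast
qed

end

end

theory Submission
  imports Defs
begin

text \<open>
  A graph is recurrent as soon as it carries finitely supported functions that are \<open>1\<close> at some
  vertex and have arbitrarily small Dirichlet energy. Let \<open>q n x\<close> be the probability that the walk
  is at \<open>x\<close> at time \<open>n\<close>, divided by the degree of \<open>x\<close>, and let \<open>pot\<close> be the sum of the \<open>q n\<close>.
  The expected number of crossings of an edge \<open>xy\<close> is \<open>pot x + pot y\<close>, and \<open>pot\<close> is the potential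
  of a unit flow from the starting vertex to infinity.

  If \<open>pot\<close> is infinite, the partial sums of the \<open>q n\<close>, suitably normalised, show that the graph
  itself is recurrent, and small energy is inherited by subgraphs. Otherwise let \<open>F\<close> be \<open>pot\<close>
  truncated to increase linearly from \<open>0\<close> to \<open>1\<close> as \<open>pot\<close> increases from \<open>\<delta> / 2\<close> to \<open>\<delta>\<close>. Then
  \<open>(pot x + pot y) (F x - F y)\<^sup>2\<close> is at most a constant times \<open>(pot x - pot y) (F x - F y)\<close>, whose
  sum is at most the flow, so the expected energy of \<open>F\<close> on the trace is bounded uniformly in \<open>\<delta>\<close>.
  Almost surely \<open>pot\<close> tends to \<open>0\<close> along the walk, so that \<open>F\<close> is finitely supported on the trace
  and equals \<open>1\<close> on any given finite set when \<open>\<delta>\<close> is small. On a transient graph the conductance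
  to infinity of exhausting finite sets would be unbounded; concretely, averages of suitable such
  \<open>F\<close> have energy tending to \<open>0\<close>.
\<close>

section \<open>Dirichlet energy\<close>

text \<open>Oriented edges, stored as tail and edge so that parallel edges stay distinct. In a
  well-formed multigraph every edge has exactly two of them.\<close>

definition darts :: "('v, 'e) multigraph \<Rightarrow> ('v \<times> 'e) set" where
  "darts G = {(x, e). e \<in> edges G \<and> x \<in> ends G e}"

definition grad :: "('v, 'e) multigraph \<Rightarrow> ('v \<Rightarrow> real) \<Rightarrow> 'v \<times> 'e \<Rightarrow> real" where
  "grad G f = (\<lambda>(x, e). f x - f (other_end G x e))"

text \<open>Every edge carries two darts, so this bounds twice the usual energy.\<close>

definition energy_le :: "('v, 'e) multigraph \<Rightarrow> ('v \<Rightarrow> real) \<Rightarrow> real \<Rightarrow> bool" where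
  "energy_le G f c \<longleftrightarrow> (\<forall>A. finite A \<longrightarrow> A \<subseteq> darts G \<longrightarrow> (\<Sum>d\<in>A. (grad G f d)\<^sup>2) \<le> c)"

text \<open>Only values on \<open>verts G\<close> count, so a function with infinite support on a
  graph may be finitely supported on its trace.\<close>

definition fin_supp :: "('v, 'e) multigraph \<Rightarrow> ('v \<Rightarrow> real) \<Rightarrow> bool" where
  "fin_supp G f \<longleftrightarrow> finite {x \<in> verts G. f x \<noteq> 0}"

text \<open>The infimum of these energies is, up to a factor of two, the effective conductance from
  \<open>z\<close> to infinity; here it is required to vanish.\<close>

definition null_capacity :: "('v, 'e) multigraph \<Rightarrow> 'v \<Rightarrow> bool" where
  "null_capacity G z \<longleftrightarrow> (\<forall>\<epsilon>>0. \<exists>F. fin_supp G F \<and> F z = 1 \<and> energy_le G F \<epsilon>)"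

definition lap :: "('v, 'e) multigraph \<Rightarrow> ('v \<Rightarrow> real) \<Rightarrow> 'v \<Rightarrow> real" where
  "lap G f x = (\<Sum>e\<in>incident G x. f x - f (other_end G x e))"

lemma energy_leD: "energy_le G f c \<Longrightarrow> finite A \<Longrightarrow> A \<subseteq> darts G \<Longrightarrow> (\<Sum>d\<in>A. (grad G f d)\<^sup>2) \<le> c"
  by (auto simp: energy_le_def)

lemma energy_le_mult:
  assumes "energy_le G f c" shows "energy_le G (\<lambda>x. a * f x) (a\<^sup>2 * c)"
proof -
  have "grad G (\<lambda>x. a * f x) d = a * grad G f d" for d
    by (cases d) (simp add: grad_def algebra_simps)
  then have "(\<Sum>d\<in>A. (grad G (\<lambda>x. a * f x) d)\<^sup>2) = a\<^sup>2 * (\<Sum>d\<in>A. (grad G f d)\<^sup>2)" for A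
    by (simp add: power_mult_distrib sum_distrib_left)
  then show ?thesis
    using assms by (auto simp: energy_le_def intro!: mult_left_mono)
qed

lemma energy_le_mono: "energy_le G f c \<Longrightarrow> c \<le> c' \<Longrightarrow> energy_le G f c'"
  by (force simp: energy_le_def)

section \<open>Darts, summation by parts and functions of low energy\<close>

locale walkable_graph =
  fixes G :: "('v, 'e) multigraph"
  assumes walkable: "walkable G"
begin

abbreviation opp :: "'v \<Rightarrow> 'e \<Rightarrow> 'v" where "opp \<equiv> other_end G"
abbreviation inc :: "'v \<Rightarrow> 'e set" where "inc \<equiv> incident G"
abbreviation deg :: "'v \<Rightarrow> real" where "deg x \<equiv> real (vdegree G x)"

lemma finite_inc: "v \<in> verts G \<Longrightarrow> finite (inc v)"
  and deg_pos: "v \<in> verts G \<Longrightarrow> deg v > 0"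
  using walkable by (force simp: walkable_def)+

lemma ends_opp: "e \<in> inc v \<Longrightarrow> ends G e = {v, opp v e}"
  using walkable ends_other_end[of G] by (auto simp: walkable_def connected_multigraph_def)

lemma opp_neq: "e \<in> inc v \<Longrightarrow> opp v e \<noteq> v"
  using ends_opp[of e v] walkable by (auto simp: walkable_def wf_multigraph_def incident_def)

lemma opp_verts: "e \<in> inc v \<Longrightarrow> opp v e \<in> verts G"
  using ends_opp[of e v] walkable by (auto simp: walkable_def wf_multigraph_def incident_def)

lemma inc_verts: "e \<in> inc v \<Longrightarrow> v \<in> verts G"
  using walkable by (auto simp: walkable_def wf_multigraph_def incident_def)

lemma inc_opp: "e \<in> inc v \<Longrightarrow> e \<in> inc (opp v e)"
  using ends_opp[of e v] by (auto simp: incident_def)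

lemma ends_eq_opp: "e \<in> edges G \<Longrightarrow> ends G e = {v, w} \<Longrightarrow> w = opp v e"
  using ends_opp[of e v] opp_neq[of e v] by (auto simp: incident_def doubleton_eq_iff)

lemma opp_opp: "e \<in> inc v \<Longrightarrow> opp (opp v e) e = v"
  using ends_eq_opp[of e "opp v e" v] ends_opp[of e v] by (auto simp: incident_def insert_commute)

lemma darts_iff: "(x, e) \<in> darts G \<longleftrightarrow> e \<in> inc x"
  by (auto simp: darts_def incident_def)

definition flip :: "'v \<times> 'e \<Rightarrow> 'v \<times> 'e" where
  "flip = (\<lambda>(x, e). (opp x e, e))"

lemma flip_flip: "d \<in> darts G \<Longrightarrow> flip (flip d) = d"
  by (cases d) (auto simp: flip_def darts_iff opp_opp)

lemma flip_darts: "d \<in> darts G \<Longrightarrow> flip d \<in> darts G"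
  by (cases d) (auto simp: flip_def darts_iff inc_opp)

lemma grad_alt: "grad G f d = f (fst d) - f (fst (flip d))"
  by (cases d) (simp add: grad_def flip_def)

lemma fst_darts: "d \<in> darts G \<Longrightarrow> fst d \<in> verts G"
  by (cases d) (auto simp: darts_iff inc_verts)

definition near :: "'v set \<Rightarrow> 'v set" where
  "near S = S \<union> (\<Union>x\<in>S. opp x ` inc x)"

text \<open>The darts touching \<open>S\<close>: a function vanishing off \<open>S\<close> has zero
  gradient on all others.\<close>

definition Darts :: "'v set \<Rightarrow> ('v \<times> 'e) set" where
  "Darts S = {d \<in> darts G. fst d \<in> S \<or> fst (flip d) \<in> S}"

lemma near_fin: "finite S \<Longrightarrow> S \<subseteq> verts G \<Longrightarrow> finite (near S)"
  and near_verts: "S \<subseteq> verts G \<Longrightarrow> near S \<subseteq> verts G"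
  and subset_near: "S \<subseteq> near S"
  using finite_inc opp_verts by (auto simp: near_def)

lemma mem_near: "e \<in> inc x \<Longrightarrow> opp x e \<in> S \<Longrightarrow> x \<in> near S"
  using opp_opp[of e x] inc_opp[of e x] by (force simp: near_def)

lemma Darts_near: "Darts S \<subseteq> Sigma (near S) inc"
proof
  fix d assume "d \<in> Darts S"
  then show "d \<in> Sigma (near S) inc"
    by (cases d) (use subset_near in \<open>auto simp: Darts_def darts_iff flip_def intro: mem_near\<close>)
qed

lemma finite_Darts: "finite S \<Longrightarrow> S \<subseteq> verts G \<Longrightarrow> finite (Darts S)"
  by (rule finite_subset[OF Darts_near])
     (use near_fin near_verts finite_inc in \<open>blast intro: finite_SigmaI\<close>)

lemma sum_flip: "(\<Sum>d\<in>Darts S. \<phi> (flip d)) = (\<Sum>d\<in>Darts S. \<phi> d)"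
  by (rule sum.reindex_bij_witness[of _ flip flip])
     (auto simp: Darts_def flip_flip flip_darts)

text \<open>Darts are grouped by their tail; those of \<open>Darts S\<close> with tail outside
  \<open>S\<close> contribute nothing.\<close>

lemma sum_Darts:
  assumes S: "finite S" "S \<subseteq> verts G" and f: "\<And>x. x \<in> verts G \<Longrightarrow> x \<notin> S \<Longrightarrow> f x = 0"
  shows "(\<Sum>d\<in>Darts S. f (fst d) * \<phi> d :: real) = (\<Sum>x\<in>S. f x * (\<Sum>e\<in>inc x. \<phi> (x, e)))"
proof -
  have sub: "Sigma S inc \<subseteq> Darts S" by (auto simp: Darts_def darts_iff)
  have "(\<Sum>x\<in>S. f x * (\<Sum>e\<in>inc x. \<phi> (x, e))) = (\<Sum>d\<in>Sigma S inc. f (fst d) * \<phi> d)"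
    using sum.Sigma[OF S(1), of inc "\<lambda>x e. f x * \<phi> (x, e)"] finite_inc S(2)
    by (simp add: sum_distrib_left split_def subset_iff)
  also have "\<dots> = (\<Sum>d\<in>Darts S. f (fst d) * \<phi> d)"
  proof (rule sum.mono_neutral_left[OF finite_Darts[OF S] sub], intro ballI)
    fix d assume "d \<in> Darts S - Sigma S inc"
    then have "f (fst d) = 0"
      by (cases d) (auto simp: Darts_def darts_iff intro: f inc_verts)
    then show "f (fst d) * \<phi> d = 0" by simp
  qed
  finally show ?thesis by simp
qed

text \<open>Symmetry of the adjacency operator: both sides sum \<open>f\<close> at one end of a dart
  times \<open>g\<close> at the other, and reversing darts exchanges them. \<open>T\<close> has to
  contain the neighbours of \<open>S\<close>, where the inner sum on the left may be
  nonzero.\<close>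

lemma sum_inc_swap:
  assumes S: "finite S" "S \<subseteq> verts G" and f: "\<And>x. x \<in> verts G \<Longrightarrow> x \<notin> S \<Longrightarrow> f x = 0"
    and T: "near S \<subseteq> T" "finite T" "T \<subseteq> verts G"
  shows "(\<Sum>y\<in>T. g y * (\<Sum>e\<in>inc y. f (opp y e)) :: real) = (\<Sum>x\<in>S. f x * (\<Sum>e\<in>inc x. g (opp x e)))"
proof -
  have sub: "Darts S \<subseteq> Sigma T inc" using Darts_near T(1) by blast
  have "(\<Sum>y\<in>T. g y * (\<Sum>e\<in>inc y. f (opp y e))) = (\<Sum>d\<in>Sigma T inc. f (fst (flip d)) * g (fst d))"
    using sum.Sigma[OF T(2), of inc "\<lambda>y e. f (opp y e) * g y"] finite_inc T(3)
    by (simp add: sum_distrib_left flip_def split_def mult.commute subset_iff)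
  also have "\<dots> = (\<Sum>d\<in>Darts S. f (fst (flip d)) * g (fst d))"
  proof (rule sum.mono_neutral_right[OF _ sub])
    show "finite (Sigma T inc)" using T finite_inc by auto
    show "\<forall>d\<in>Sigma T inc - Darts S. f (fst (flip d)) * g (fst d) = 0"
      by (auto simp: Darts_def darts_iff flip_def f opp_verts)
  qed
  also have "\<dots> = (\<Sum>d\<in>Darts S. f (fst (flip d)) * g (fst (flip (flip d))))"
    by (rule sum.cong) (auto simp: Darts_def flip_flip)
  also have "\<dots> = (\<Sum>d\<in>Darts S. f (fst d) * g (fst (flip d)))"
    by (rule sum_flip)
  also have "\<dots> = (\<Sum>x\<in>S. f x * (\<Sum>e\<in>inc x. g (opp x e)))"
    using sum_Darts[where \<phi> = "\<lambda>d. g (fst (flip d))", OF S f] by (simp add: flip_def)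
  finally show ?thesis .
qed

text \<open>Summation by parts. Reversing darts changes the sign of the gradient of
  \<open>h\<close>, so the terms with \<open>f\<close> at the head give a second copy of those with
  \<open>f\<close> at the tail; hence the factor 2.\<close>

lemma green_identity:
  assumes S: "finite S" "S \<subseteq> verts G" and f: "\<And>x. x \<in> verts G \<Longrightarrow> x \<notin> S \<Longrightarrow> f x = 0"
  shows "(\<Sum>d\<in>Darts S. grad G f d * grad G h d) = 2 * (\<Sum>x\<in>S. f x * lap G h x)"
proof -
  have "(\<Sum>d\<in>Darts S. grad G f d * grad G h d)
     = (\<Sum>d\<in>Darts S. f (fst d) * grad G h d) - (\<Sum>d\<in>Darts S. f (fst (flip d)) * grad G h d)"
    by (simp add: grad_alt[of f] left_diff_distrib sum_subtractf)
  also have "(\<Sum>d\<in>Darts S. f (fst (flip d)) * grad G h d)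
      = (\<Sum>d\<in>Darts S. - (f (fst (flip d)) * grad G h (flip d)))"
    by (rule sum.cong) (auto simp: Darts_def grad_alt flip_flip algebra_simps)
  also have "\<dots> = - (\<Sum>d\<in>Darts S. f (fst d) * grad G h d)"
    unfolding sum_negf by (subst sum_flip) simp
  also have "(\<Sum>d\<in>Darts S. f (fst d) * grad G h d) = (\<Sum>x\<in>S. f x * lap G h x)"
    using sum_Darts[where \<phi> = "grad G h", OF S f] by (simp add: lap_def grad_def)
  finally show ?thesis by simp
qed

lemma lap_eq: "x \<in> verts G \<Longrightarrow> lap G f x = deg x * f x - (\<Sum>e\<in>inc x. f (opp x e))"
  by (simp add: lap_def sum_subtractf vdegree_def)

text \<open>Trades an arbitrary finite set of darts for \<open>Darts S\<close>, on which
  \<open>green_identity\<close> is available.\<close>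

lemma sum_le_sum_Darts:
  assumes S: "finite S" "S \<subseteq> verts G" and A: "finite A" "A \<subseteq> darts G"
    and zero: "\<And>d. d \<in> darts G \<Longrightarrow> d \<notin> Darts S \<Longrightarrow> \<phi> d = 0"
    and nonneg: "\<And>d. d \<in> Darts S \<Longrightarrow> 0 \<le> \<phi> d"
  shows "sum \<phi> A \<le> (sum \<phi> (Darts S) :: real)"
proof -
  have "sum \<phi> A = sum \<phi> (A \<inter> Darts S)"
    using A zero by (intro sum.mono_neutral_right) auto
  also have "\<dots> \<le> sum \<phi> (Darts S)"
    using finite_Darts[OF S] nonneg by (intro sum_mono2) auto
  finally show ?thesis .
qed

lemma connected_induct [consumes 2, case_names base step]:
  assumes "z \<in> verts G" "y \<in> verts G" "P z"
    and "\<And>x e. x \<in> verts G \<Longrightarrow> e \<in> inc x \<Longrightarrow> P x \<Longrightarrow> P (opp x e)"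
  shows "P y"
proof -
  have "(z, y) \<in> {(x, y). \<exists>e\<in>edges G. ends G e = {x, y}}\<^sup>*"
    using walkable assms by (auto simp: walkable_def connected_multigraph_def)
  then have "P y"
  proof (induction rule: rtrancl_induct)
    case (step a b)
    then obtain e where e: "e \<in> edges G" "ends G e = {a, b}" by auto
    then have "e \<in> inc a" by (auto simp: incident_def)
    moreover have "b = opp a e" using ends_eq_opp e by simp
    ultimately show ?case using assms(4)[of a e] step.IH inc_verts by blast
  qed (fact assms(3))
  then show ?thesis .
qed

text \<open>The constant is the length of a path from \<open>z\<close> to \<open>y\<close>, whatever
  the function: an energy of at most \<open>\<delta>\<^sup>2\<close> allows a difference of at most
  \<open>\<delta>\<close> across each edge.\<close>

lemma energy_oscillation:
  assumes "z \<in> verts G" "y \<in> verts G"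
  shows "\<exists>K\<ge>0. \<forall>f \<delta>. \<delta> \<ge> 0 \<longrightarrow> energy_le G f (\<delta>\<^sup>2) \<longrightarrow> \<bar>f y - f z\<bar> \<le> K * \<delta>"
  using assms
proof (induction rule: connected_induct)
  case base
  show ?case by (intro exI[of _ 0]) auto
next
  case (step x e)
  then obtain K where K: "K \<ge> 0"
    "\<And>f \<delta>. \<delta> \<ge> 0 \<Longrightarrow> energy_le G f (\<delta>\<^sup>2) \<Longrightarrow> \<bar>f x - f z\<bar> \<le> K * \<delta>" by blast
  have "\<bar>f (opp x e) - f z\<bar> \<le> (K + 1) * \<delta>" if "\<delta> \<ge> 0" "energy_le G f (\<delta>\<^sup>2)" for f \<delta>
  proof -
    have "(f x - f (opp x e))\<^sup>2 \<le> \<delta>\<^sup>2"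
      using energy_leD[OF that(2), of "{(x, e)}"] step by (simp add: darts_iff grad_def)
    then have "\<bar>f x - f (opp x e)\<bar> \<le> \<delta>" using that(1) by (simp add: abs_le_square_iff[symmetric])
    then show ?thesis using K(2)[OF that] by (simp add: algebra_simps)
  qed
  then show ?case using K(1) by (intro exI[of _ "K + 1"]) auto
qed

text \<open>Low energy leaves little room for oscillation between \<open>z\<close> and
  \<open>y\<close>, so the value 1 at \<open>z\<close> nearly persists at \<open>y\<close>.\<close>

lemma null_capacity_approx:
  assumes "null_capacity G z" "z \<in> verts G" "y \<in> verts G" "\<epsilon> > 0"
  shows "\<exists>F. fin_supp G F \<and> F z = 1 \<and> energy_le G F (\<epsilon>\<^sup>2) \<and> \<bar>F y - 1\<bar> \<le> \<epsilon>"
proof -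
  obtain K where K: "K \<ge> 0" "\<And>f \<delta>. \<delta> \<ge> 0 \<Longrightarrow> energy_le G f (\<delta>\<^sup>2) \<Longrightarrow> \<bar>f y - f z\<bar> \<le> K * \<delta>"
    using energy_oscillation[OF assms(2,3)] by blast
  define \<delta> where "\<delta> = \<epsilon> / (K + 1)"
  have d: "\<delta> > 0" "\<delta> \<le> \<epsilon>" "K * \<delta> \<le> \<epsilon>"
    using K(1) assms(4) by (auto simp: \<delta>_def field_simps)
  obtain F where F: "fin_supp G F" "F z = 1" "energy_le G F (\<delta>\<^sup>2)"
    using assms(1) d(1) unfolding null_capacity_def by (meson zero_less_power)
  have "\<bar>F y - 1\<bar> \<le> \<epsilon>" using K(2)[OF _ F(3)] d F(2) by simp
  moreover have "energy_le G F (\<epsilon>\<^sup>2)" using F(3) d by (auto intro: energy_le_mono power_mono)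
  ultimately show ?thesis using F by blast
qed

text \<open>A function that is nearly 1 at \<open>y\<close> is divided by its value there. This
  value is at least 1/2, so the energy grows by a factor of at most four, which the choice of
  \<open>\<delta>\<close> absorbs.\<close>

lemma null_capacity_any:
  assumes "null_capacity G z" "z \<in> verts G" "y \<in> verts G"
  shows "null_capacity G y"
  unfolding null_capacity_def
proof (intro allI impI)
  fix \<epsilon> :: real assume "\<epsilon> > 0"
  define \<delta> where "\<delta> = min (1/2) (sqrt \<epsilon> / 2)"
  have d: "\<delta> > 0" "\<delta> \<le> 1/2" "\<delta> \<le> sqrt \<epsilon> / 2" using \<open>\<epsilon> > 0\<close> by (auto simp: \<delta>_def)
  obtain F where F: "fin_supp G F" "energy_le G F (\<delta>\<^sup>2)" "\<bar>F y - 1\<bar> \<le> \<delta>"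
    using null_capacity_approx[OF assms d(1)] by blast
  have Fy: "F y \<ge> 1/2" using F(3) d by linarith
  have "(1 / F y)\<^sup>2 * \<delta>\<^sup>2 \<le> 2\<^sup>2 * (sqrt \<epsilon> / 2)\<^sup>2"
    using Fy d by (intro mult_mono power_mono) (auto simp: field_simps)
  also have "\<dots> = \<epsilon>" using \<open>\<epsilon> > 0\<close> by (simp add: power_divide)
  finally have "energy_le G (\<lambda>x. 1 / F y * F x) \<epsilon>"
    using energy_le_mult[OF F(2), of "1 / F y"] by (rule energy_le_mono[rotated])
  moreover have "fin_supp G (\<lambda>x. 1 / F y * F x)"
    using F(1) unfolding fin_supp_def by (rule finite_subset[rotated]) auto
  ultimately show "\<exists>F. fin_supp G F \<and> F y = 1 \<and> energy_le G F \<epsilon>"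
    using Fy by (intro exI[of _ "\<lambda>x. 1 / F y * F x"]) auto
qed

text \<open>
  The argument rests on the identity \<open>|\<nabla>(F u)|\<^sup>2 = \<nabla>(F\<^sup>2 u) \<nabla>u + u(x) u(y) |\<nabla>F|\<^sup>2\<close> on an
  edge \<open>xy\<close>: the first term sums to zero, so \<open>F u\<close> has no more energy than \<open>F\<close>.
\<close>

lemma harmonic_off_vanishes:
  assumes null: "null_capacity G z" and z: "z \<in> verts G" and y: "y \<in> verts G"
    and u: "u z = 0" "\<And>x. x \<in> verts G \<Longrightarrow> 0 \<le> u x \<and> u x \<le> 1"
    and harm: "\<And>x. x \<in> verts G \<Longrightarrow> x \<noteq> z \<Longrightarrow> lap G u x = 0"
  shows "u y = 0"
proof -
  have energy_mult: "energy_le G (\<lambda>x. F x * u x) c" if F: "fin_supp G F" "energy_le G F c" for F c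
    unfolding energy_le_def
  proof (intro allI impI)
    fix A assume A: "finite A" "A \<subseteq> darts G"
    define S where "S = {x \<in> verts G. F x \<noteq> 0}"
    have S: "finite S" "S \<subseteq> verts G" using F(1) by (auto simp: S_def fin_supp_def)
    have "(\<Sum>d\<in>A. (grad G (\<lambda>x. F x * u x) d)\<^sup>2) \<le> (\<Sum>d\<in>Darts S. (grad G (\<lambda>x. F x * u x) d)\<^sup>2)"
      by (rule sum_le_sum_Darts[OF S A])
         (auto simp: Darts_def grad_alt S_def fst_darts flip_darts)
    also have "\<dots> = (\<Sum>d\<in>Darts S. grad G (\<lambda>x. (F x)\<^sup>2 * u x) d * grad G u d
        + u (fst d) * u (fst (flip d)) * (grad G F d)\<^sup>2)"
      by (rule sum.cong) (auto simp: grad_alt power2_eq_square algebra_simps)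
    also have "\<dots> = 2 * (\<Sum>x\<in>S. (F x)\<^sup>2 * u x * lap G u x)
        + (\<Sum>d\<in>Darts S. u (fst d) * u (fst (flip d)) * (grad G F d)\<^sup>2)"
      unfolding sum.distrib by (subst green_identity[OF S]) (auto simp: S_def)
    \<comment> \<open>At \<open>z\<close> the factor \<open>u\<close> vanishes, elsewhere the
      Laplacian does.\<close>
    also have "(\<Sum>x\<in>S. (F x)\<^sup>2 * u x * lap G u x) = 0"
      using harm u(1) S(2) by (intro sum.neutral) auto
    also have "(\<Sum>d\<in>Darts S. u (fst d) * u (fst (flip d)) * (grad G F d)\<^sup>2)
        \<le> (\<Sum>d\<in>Darts S. (grad G F d)\<^sup>2)"
    proof (rule sum_mono)
      fix d assume "d \<in> Darts S"
      then have "fst d \<in> verts G" "fst (flip d) \<in> verts G"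
        by (auto simp: Darts_def fst_darts flip_darts)
      then have "u (fst d) * u (fst (flip d)) \<le> 1" using u(2) by (simp add: mult_le_one)
      then show "u (fst d) * u (fst (flip d)) * (grad G F d)\<^sup>2 \<le> (grad G F d)\<^sup>2"
        using mult_right_mono[of _ 1 "(grad G F d)\<^sup>2"] by simp
    qed
    also have "\<dots> \<le> c" using energy_leD[OF F(2) finite_Darts[OF S]] by (auto simp: Darts_def)
    finally show "(\<Sum>d\<in>A. (grad G (\<lambda>x. F x * u x) d)\<^sup>2) \<le> c" by simp
  qed
  obtain K where K: "K \<ge> 0" "\<And>f \<delta>. \<delta> \<ge> 0 \<Longrightarrow> energy_le G f (\<delta>\<^sup>2) \<Longrightarrow> \<bar>f y - f z\<bar> \<le> K * \<delta>"
    using energy_oscillation[OF z y] by blast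
  \<comment> \<open>The product \<open>F u\<close> vanishes at \<open>z\<close> and has energy at
    most \<open>\<delta>\<^sup>2\<close>, so it is at most \<open>K * \<delta>\<close> at
    \<open>y\<close>, while \<open>F y\<close> is at least 1/2. The two terms in
    \<open>\<delta>\<close> serve these two bounds.\<close>
  have "u y \<le> \<epsilon>" if "\<epsilon> > 0" for \<epsilon>
  proof -
    define \<delta> where "\<delta> = min (1/2) (\<epsilon> / (2 * (K + 1)))"
    have d: "\<delta> > 0" "\<delta> \<le> 1/2" "\<delta> \<le> \<epsilon> / (2 * (K + 1))"
      using that K(1) unfolding \<delta>_def by (simp_all only: min.cobounded1 min.cobounded2) simp
    have Kd: "2 * K * \<delta> \<le> \<epsilon>"
    proof -
      have "2 * K * \<delta> \<le> 2 * (K + 1) * (\<epsilon> / (2 * (K + 1)))"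
        using d K(1) by (intro mult_mono) auto
      also have "\<dots> = \<epsilon>" using K(1) by simp
      finally show ?thesis .
    qed
    obtain F where F: "fin_supp G F" "energy_le G F (\<delta>\<^sup>2)" "\<bar>F y - 1\<bar> \<le> \<delta>"
      using null_capacity_approx[OF null z y d(1)] by blast
    have "\<bar>F y * u y\<bar> \<le> K * \<delta>"
      using K(2)[OF _ energy_mult[OF F(1,2)]] d u(1) by simp
    moreover have "1/2 * u y \<le> F y * u y"
      using F(3) d u(2)[OF y] by (intro mult_right_mono) auto
    ultimately show ?thesis using Kd by linarith
  qed
  then have "u y \<le> 0" by (rule field_le_epsilon[of "u y" 0, simplified])
  then show ?thesis using u(2)[OF y] by linarith
qed

end

section \<open>The law of the walk\<close>

context walkable_graph
begin

text \<open>The ball of radius \<open>n\<close> about \<open>z\<close>. It is finite and contains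
  every possible position at time \<open>n\<close>, so sums over positions become finite
  sums.\<close>

primrec reach :: "'v \<Rightarrow> nat \<Rightarrow> 'v set" where
  "reach z 0 = {z}"
| "reach z (Suc n) = near (reach z n)"

lemma reach_verts: "z \<in> verts G \<Longrightarrow> reach z n \<subseteq> verts G"
  by (induction n) (auto dest: near_verts)

lemma finite_reach: "z \<in> verts G \<Longrightarrow> finite (reach z n)"
  by (induction n) (auto intro: near_fin dest: reach_verts)

text \<open>By connectedness the finite balls about a vertex exhaust the graph. Countability later
  allows events to be split according to the history of the walk.\<close>

lemma countable_verts: "countable (verts G)"
proof -
  obtain z where z: "z \<in> verts G" using walkable by (auto simp: walkable_def connected_multigraph_def)
  have "\<exists>n. y \<in> reach z n" if "y \<in> verts G" for y
    using z that
  proof (induction rule: connected_induct)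
    case (step x e)
    then obtain n where "x \<in> reach z n" by blast
    then have "opp x e \<in> reach z (Suc n)" using step by (auto simp: near_def)
    then show ?case by blast
  qed (auto intro: exI[of _ 0])
  then have "verts G \<subseteq> (\<Union>n. reach z n)" by blast
  then show ?thesis
    by (rule countable_subset) (auto intro: countable_finite finite_reach z)
qed

lemma countable_edges: "countable (edges G)"
proof -
  have "edges G \<subseteq> (\<Union>x\<in>verts G. inc x)"
  proof
    fix e assume e: "e \<in> edges G"
    then obtain x where "x \<in> ends G e" "x \<in> verts G"
      using walkable unfolding walkable_def wf_multigraph_def card_2_iff by blast
    then show "e \<in> (\<Union>x\<in>verts G. inc x)" using e by (auto simp: incident_def)
  qed
  then show ?thesis
    by (rule countable_subset) (auto intro: countable_finite finite_inc countable_verts)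
qed

text \<open>
  \<open>occ z B s x\<close> is the probability that the walk from \<open>z\<close> satisfies \<open>W r \<in> B r\<close> for all
  \<open>r \<le> s\<close> and \<open>W s = x\<close>, divided by the degree of \<open>x\<close>.
\<close>

primrec occ :: "'v \<Rightarrow> (nat \<Rightarrow> 'v set) \<Rightarrow> nat \<Rightarrow> 'v \<Rightarrow> real" where
  "occ z B 0 x = (if x = z \<and> x \<in> B 0 then 1 / deg x else 0)"
| "occ z B (Suc s) x = (if x \<in> B (Suc s) then (\<Sum>e\<in>inc x. occ z B s (opp x e)) / deg x else 0)"

lemma occ_nonneg: "0 \<le> occ z B s x"
  by (induction s arbitrary: x) (auto intro!: sum_nonneg divide_nonneg_nonneg)

lemma occ_eq_0: "x \<notin> reach z s \<Longrightarrow> occ z B s x = 0"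
proof (induction s arbitrary: x)
  case (Suc s)
  then have "occ z B s (opp x e) = 0" if "e \<in> inc x" for e
    using mem_near[OF that] by auto
  then show ?case by simp
qed auto

lemma occ_outside: "x \<notin> B s \<Longrightarrow> occ z B s x = 0"
  by (cases s) auto

text \<open>One step of the walk, moved by the symmetry of adjacency from the occupation density
  onto the test function \<open>g\<close>.\<close>

lemma occ_step:
  assumes z: "z \<in> verts G"
  shows "(\<Sum>x\<in>reach z (Suc s). deg x * occ z B (Suc s) x * g x)
    = (\<Sum>x\<in>reach z s. occ z B s x * (\<Sum>e\<in>inc x. indicator (B (Suc s)) (opp x e) * g (opp x e)))"
proof -
  have "(\<Sum>x\<in>reach z (Suc s). deg x * occ z B (Suc s) x * g x)
      = (\<Sum>x\<in>reach z (Suc s). (indicator (B (Suc s)) x * g x) * (\<Sum>e\<in>inc x. occ z B s (opp x e)))"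
  proof (rule sum.cong)
    fix x assume "x \<in> reach z (Suc s)"
    then have "deg x > 0" using reach_verts[OF z] deg_pos by blast
    then show "deg x * occ z B (Suc s) x * g x
        = (indicator (B (Suc s)) x * g x) * (\<Sum>e\<in>inc x. occ z B s (opp x e))" by simp
  qed simp
  also have "\<dots> = (\<Sum>x\<in>reach z s. occ z B s x * (\<Sum>e\<in>inc x. indicator (B (Suc s)) (opp x e) * g (opp x e)))"
    by (rule sum_inc_swap) (use finite_reach[OF z] reach_verts[OF z] occ_eq_0 in \<open>auto simp del: reach.simps simp: reach.simps(2)[symmetric]\<close>)
  finally show ?thesis .
qed

end

section \<open>Probabilities of events of an arbitrary walk, expressed by \<open>occ\<close>\<close>

locale srw = walkable_graph G for G :: "('v, 'e) multigraph" +
  fixes z :: 'v and M :: "'w measure" and W :: "nat \<Rightarrow> 'w \<Rightarrow> 'v" and X :: "nat \<Rightarrow> 'w \<Rightarrow> 'e"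
  assumes z: "z \<in> verts G" and srw: "simple_random_walk G z M W X"

sublocale srw \<subseteq> prob_space M
  using srw by (simp add: simple_random_walk_def)

context srw
begin

lemma W_measurable [measurable]: "W t \<in> measurable M (count_space UNIV)"
  and X_measurable [measurable]: "X t \<in> measurable M (count_space UNIV)"
proof -
  have id: "(\<lambda>x. x) \<in> measurable (count_space A) (count_space UNIV)" for A :: "'c set" by simp
  have "W t \<in> measurable M (count_space (verts G))" "X t \<in> measurable M (count_space (edges G))"
    using srw by (auto simp: simple_random_walk_def)
  then show "W t \<in> measurable M (count_space UNIV)" "X t \<in> measurable M (count_space UNIV)"
    using measurable_compose[OF _ id] by auto
qed

lemma W_in_measurable [measurable]: "Measurable.pred M (\<lambda>\<omega>. W t \<omega> \<in> B)"
  using measurable_compose[OF W_measurable, of "\<lambda>x. x \<in> B" "count_space UNIV"] by simp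

lemma W_verts: "\<omega> \<in> space M \<Longrightarrow> W t \<omega> \<in> verts G"
  and X_edges: "\<omega> \<in> space M \<Longrightarrow> X t \<omega> \<in> edges G"
proof -
  have "W t \<in> measurable M (count_space (verts G))" "X t \<in> measurable M (count_space (edges G))"
    using srw by (auto simp: simple_random_walk_def)
  then show "\<omega> \<in> space M \<Longrightarrow> W t \<omega> \<in> verts G" "\<omega> \<in> space M \<Longrightarrow> X t \<omega> \<in> edges G"
    by (auto dest: measurable_space)
qed

lemma AE_start: "AE \<omega> in M. W 0 \<omega> = z"
  using srw by (simp add: simple_random_walk_def)

lemma AE_ends: "AE \<omega> in M. \<forall>t. ends G (X t \<omega>) = {W t \<omega>, W (Suc t) \<omega>}"
  using srw by (auto simp: simple_random_walk_def AE_all_countable)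

lemma AE_step: "AE \<omega> in M. \<forall>t. X t \<omega> \<in> inc (W t \<omega>) \<and> W (Suc t) \<omega> = opp (W t \<omega>) (X t \<omega>)"
  using AE_ends
proof (rule AE_mp, intro AE_I2 impI allI)
  fix \<omega> t assume "\<omega> \<in> space M" "\<forall>t. ends G (X t \<omega>) = {W t \<omega>, W (Suc t) \<omega>}"
  then show "X t \<omega> \<in> inc (W t \<omega>) \<and> W (Suc t) \<omega> = opp (W t \<omega>) (X t \<omega>)"
    using X_edges[of \<omega> t] ends_eq_opp[of "X t \<omega>" "W t \<omega>" "W (Suc t) \<omega>"] by (auto simp: incident_def)
qed

lemma AE_reach: "AE \<omega> in M. \<forall>t. W t \<omega> \<in> reach z t"
  using AE_start AE_step
proof eventually_elim
  case (elim \<omega>)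
  have "W t \<omega> \<in> reach z t" for t
  proof (induction t)
    case (Suc t) then show ?case using elim by (auto simp: near_def)
  qed (use elim in simp)
  then show ?case by blast
qed

text \<open>The defining property of the walk in product form, which also covers histories of
  probability zero.\<close>

lemma prob_history_step:
  fixes v :: "nat \<Rightarrow> 'v" and e :: "nat \<Rightarrow> 'e"
  assumes "a \<in> inc (v s)"
  defines "H \<equiv> {\<omega> \<in> space M. (\<forall>r<s. W r \<omega> = v r \<and> X r \<omega> = e r) \<and> W s \<omega> = v s}"
  shows "prob {\<omega> \<in> H. X s \<omega> = a} = prob H / deg (v s)"
proof (cases "prob H > 0")
  case True
  then have "\<P>(\<omega> in M. X s \<omega> = a \<bar> (\<forall>r<s. W r \<omega> = v r \<and> X r \<omega> = e r) \<and> W s \<omega> = v s) = 1 / deg (v s)"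
    using srw assms(1) by (simp add: simple_random_walk_def H_def)
  moreover have "{\<omega> \<in> space M. X s \<omega> = a \<and> (\<forall>r<s. W r \<omega> = v r \<and> X r \<omega> = e r) \<and> W s \<omega> = v s}
      = {\<omega> \<in> H. X s \<omega> = a}" by (auto simp: H_def)
  ultimately show ?thesis using True by (simp add: cond_prob_def H_def[symmetric] field_simps)
next
  case False
  have "H \<in> sets M" unfolding H_def by measurable
  then have "prob {\<omega> \<in> H. X s \<omega> = a} \<le> prob H" by (intro finite_measure_mono) auto
  then show ?thesis
    using False measure_nonneg[of M "{\<omega> \<in> H. X s \<omega> = a}"] measure_nonneg[of M H]
    by (simp add: antisym)
qed

text \<open>Markov property for pasts described by the sets \<open>B r\<close>: the event is a
  countable disjoint union of complete histories, and each of them obeys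
  \<open>prob_history_step\<close>.\<close>

lemma prob_step:
  assumes a: "a \<in> inc x"
  shows "prob {\<omega> \<in> space M. (\<forall>r\<le>s. W r \<omega> \<in> B r) \<and> W s \<omega> = x \<and> X s \<omega> = a}
    = prob {\<omega> \<in> space M. (\<forall>r\<le>s. W r \<omega> \<in> B r) \<and> W s \<omega> = x} / deg x"
proof (cases "x \<in> B s")
  case xB: True
  \<comment> \<open>Histories before time \<open>s\<close> are coded as lists, so that
    \<open>I\<close> is countable.\<close>
  define I where "I = {(vl, el). vl \<in> lists (verts G) \<and> el \<in> lists (edges G) \<and>
    length vl = s \<and> length el = s \<and> (\<forall>r<s. vl ! r \<in> B r)}"
  define E where "E = (\<lambda>(vl, el). {\<omega> \<in> space M. (\<forall>r<s. W r \<omega> = vl ! r \<and> X r \<omega> = el ! r) \<and> W s \<omega> = x})"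
  define E' where "E' = (\<lambda>i. {\<omega> \<in> E i. X s \<omega> = a})"
  have "countable (lists (verts G) \<times> lists (edges G))"
    using countable_verts countable_edges by auto
  then have I: "countable I" by (rule countable_subset[rotated]) (auto simp: I_def)
  have sets: "E i \<in> sets M" "E' i \<in> sets M" for i
    unfolding E'_def E_def by (cases i, simp, measurable)+
  have disj: "disjoint_family_on E I"
    unfolding disjoint_family_on_def
  proof (intro ballI impI)
    fix i j assume ij: "i \<in> I" "j \<in> I" "i \<noteq> j"
    obtain vl el vl' el' where [simp]: "i = (vl, el)" "j = (vl', el')" by (cases i, cases j)
    have "\<exists>r<s. vl ! r \<noteq> vl' ! r \<or> el ! r \<noteq> el' ! r"
      using ij by (auto simp: I_def list_eq_iff_nth_eq)
    then show "E i \<inter> E j = {}" by (auto simp: E_def)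
  qed
  then have disj': "disjoint_family_on E' I"
    unfolding disjoint_family_on_def E'_def by blast
  have UN: "{\<omega> \<in> space M. (\<forall>r\<le>s. W r \<omega> \<in> B r) \<and> W s \<omega> = x} = (\<Union>i\<in>I. E i)" (is "?A = _")
  proof (intro set_eqI iffI)
    fix \<omega> assume \<omega>: "\<omega> \<in> ?A"
    then have "\<omega> \<in> E (map (\<lambda>r. W r \<omega>) [0..<s], map (\<lambda>r. X r \<omega>) [0..<s])" by (auto simp: E_def)
    moreover have "(map (\<lambda>r. W r \<omega>) [0..<s], map (\<lambda>r. X r \<omega>) [0..<s]) \<in> I"
      using \<omega> W_verts X_edges by (auto simp: I_def)
    ultimately show "\<omega> \<in> (\<Union>i\<in>I. E i)" by blast
  next
    fix \<omega> assume "\<omega> \<in> (\<Union>i\<in>I. E i)"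
    then show "\<omega> \<in> ?A" using xB by (auto simp: I_def E_def le_less)
  qed
  have UN': "{\<omega> \<in> space M. (\<forall>r\<le>s. W r \<omega> \<in> B r) \<and> W s \<omega> = x \<and> X s \<omega> = a} = (\<Union>i\<in>I. E' i)"
    using UN by (auto simp: E'_def set_eq_iff)
  have eq: "emeasure M (E' i) = ennreal (1 / deg x) * emeasure M (E i)" if "i \<in> I" for i
  proof -
    obtain vl el where i [simp]: "i = (vl, el)" by (cases i)
    \<comment> \<open>The list of positions is padded with \<open>x\<close> at time
      \<open>s\<close>, the vertex from which the next edge is chosen.\<close>
    have "prob (E' i) = prob (E i) / deg x"
      using prob_history_step[of a "\<lambda>r. if r < s then vl ! r else x" s "\<lambda>r. el ! r"] a
      by (simp add: E'_def E_def cong: conj_cong)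
    then show ?thesis
      by (simp add: emeasure_eq_measure ennreal_mult[symmetric])
  qed
  have "emeasure M (\<Union>i\<in>I. E' i) = (\<integral>\<^sup>+i. ennreal (1 / deg x) * emeasure M (E i) \<partial>count_space I)"
    by (subst emeasure_UN_countable[OF _ I disj']) (auto simp: sets eq intro!: nn_integral_cong)
  also have "\<dots> = ennreal (1 / deg x) * emeasure M (\<Union>i\<in>I. E i)"
    by (subst emeasure_UN_countable[OF _ I disj]) (auto simp: sets nn_integral_cmult)
  finally have "ennreal (prob (\<Union>i\<in>I. E' i)) = ennreal (1 / deg x * prob (\<Union>i\<in>I. E i))"
    by (simp add: emeasure_eq_measure ennreal_mult[symmetric])
  then have "prob (\<Union>i\<in>I. E' i) = 1 / deg x * prob (\<Union>i\<in>I. E i)"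
    by (subst (asm) ennreal_inj) auto
  then show ?thesis unfolding UN UN' by simp
next
  case False
  then have "{\<omega> \<in> space M. (\<forall>r\<le>s. W r \<omega> \<in> B r) \<and> W s \<omega> = x \<and> X s \<omega> = a} = {}"
    "{\<omega> \<in> space M. (\<forall>r\<le>s. W r \<omega> \<in> B r) \<and> W s \<omega> = x} = {}" by auto
  then show ?thesis by (simp only: measure_empty div_0)
qed

text \<open>The event is split by the last edge \<open>a\<close> crossed. Arriving through
  \<open>a\<close> means having been at \<open>opp x a\<close>, and the degree of that vertex
  cancels against the uniform choice of the edge.\<close>

lemma prob_at:
  assumes "x \<in> verts G"
  shows "prob {\<omega> \<in> space M. (\<forall>r\<le>s. W r \<omega> \<in> B r) \<and> W s \<omega> = x} = deg x * occ z B s x"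
  using assms
proof (induction s arbitrary: x)
  case 0
  have "prob {\<omega> \<in> space M. (\<forall>r\<le>0. W r \<omega> \<in> B r) \<and> W 0 \<omega> = x}
      = prob (if x = z \<and> x \<in> B 0 then space M else {})"
    using AE_start by (intro finite_measure_eq_AE) (auto elim!: eventually_mono)
  then show ?case using deg_pos[OF 0] by (auto simp: prob_space)
next
  case (Suc s)
  show ?case
  proof (cases "x \<in> B (Suc s)")
    case True
    define E where "E = (\<lambda>a. {\<omega> \<in> space M. (\<forall>r\<le>s. W r \<omega> \<in> B r) \<and> W s \<omega> = opp x a \<and> X s \<omega> = a})"
    have sets: "E a \<in> sets M" for a
      unfolding E_def by measurable
    have "prob {\<omega> \<in> space M. (\<forall>r\<le>Suc s. W r \<omega> \<in> B r) \<and> W (Suc s) \<omega> = x} = prob (\<Union>a\<in>inc x. E a)"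
    proof (rule finite_measure_eq_AE)
      show "AE \<omega> in M. (\<omega> \<in> {\<omega> \<in> space M. (\<forall>r\<le>Suc s. W r \<omega> \<in> B r) \<and> W (Suc s) \<omega> = x}) =
          (\<omega> \<in> (\<Union>a\<in>inc x. E a))"
        using AE_step
      proof eventually_elim
        case (elim \<omega>)
        then have "X s \<omega> \<in> inc (W s \<omega>)" "W (Suc s) \<omega> = opp (W s \<omega>) (X s \<omega>)" by auto
        then show ?case using True opp_opp[of "X s \<omega>"] inc_opp[of "X s \<omega>"]
          by (auto simp: E_def le_Suc_eq)
      qed
      show "(\<Union>a\<in>inc x. E a) \<in> sets M" using sets finite_inc[OF Suc.prems] by auto
    qed measurable
    also have "\<dots> = (\<Sum>a\<in>inc x. prob (E a))"
    proof (rule finite_measure_finite_Union)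
      show "disjoint_family_on E (inc x)" by (auto simp: disjoint_family_on_def E_def)
    qed (use finite_inc[OF Suc.prems] sets in auto)
    also have "\<dots> = (\<Sum>a\<in>inc x. occ z B s (opp x a))"
    proof (rule sum.cong)
      fix a assume a: "a \<in> inc x"
      have "prob (E a) = deg (opp x a) * occ z B s (opp x a) / deg (opp x a)"
        unfolding E_def prob_step[OF inc_opp[OF a]] Suc.IH[OF opp_verts[OF a]] ..
      then show "prob (E a) = occ z B s (opp x a)" using deg_pos[OF opp_verts[OF a]] by simp
    qed simp
    finally show ?thesis using deg_pos[OF Suc.prems] True by simp
  next
    case False
    then have "{\<omega> \<in> space M. (\<forall>r\<le>Suc s. W r \<omega> \<in> B r) \<and> W (Suc s) \<omega> = x} = {}" by auto
    then show ?thesis using False by (simp only: measure_empty occ.simps if_False mult_zero_right)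
  qed
qed

lemma prob_stay:
  "prob {\<omega> \<in> space M. \<forall>r\<le>s. W r \<omega> \<in> B r} = (\<Sum>x\<in>reach z s. deg x * occ z B s x)"
proof -
  define E where "E = (\<lambda>x. {\<omega> \<in> space M. (\<forall>r\<le>s. W r \<omega> \<in> B r) \<and> W s \<omega> = x})"
  have sets: "E x \<in> sets M" for x
    unfolding E_def by measurable
  have "prob {\<omega> \<in> space M. \<forall>r\<le>s. W r \<omega> \<in> B r} = prob (\<Union>x\<in>reach z s. E x)"
  proof (rule finite_measure_eq_AE)
    show "AE \<omega> in M. (\<omega> \<in> {\<omega> \<in> space M. \<forall>r\<le>s. W r \<omega> \<in> B r}) = (\<omega> \<in> (\<Union>x\<in>reach z s. E x))"
      using AE_reach by eventually_elim (auto simp: E_def)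
    show "(\<Union>x\<in>reach z s. E x) \<in> sets M" using sets finite_reach[OF z] by auto
  qed measurable
  also have "\<dots> = (\<Sum>x\<in>reach z s. prob (E x))"
  proof (rule finite_measure_finite_Union)
    show "disjoint_family_on E (reach z s)" by (auto simp: disjoint_family_on_def E_def)
  qed (use finite_reach[OF z] sets in auto)
  also have "\<dots> = (\<Sum>x\<in>reach z s. deg x * occ z B s x)"
    unfolding E_def using reach_verts[OF z] by (intro sum.cong prob_at) auto
  finally show ?thesis .
qed

text \<open>The degree in \<open>prob_at\<close> cancels the uniform choice of the edge, which is
  what makes division by the degree natural in \<open>occ\<close>.\<close>

lemma prob_cross:
  assumes "a \<in> inc x"
  shows "prob {\<omega> \<in> space M. W s \<omega> = x \<and> X s \<omega> = a} = occ z (\<lambda>_. UNIV) s x"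
  using prob_step[OF assms, of s "\<lambda>_. UNIV"] prob_at[of x s "\<lambda>_. UNIV"] inc_verts[OF assms] deg_pos[of x]
  by simp

end

section \<open>Recurrence from null capacity\<close>

context walkable_graph
begin

text \<open>The probability that the walk from \<open>x\<close> stays away from \<open>y\<close> at
  all times up to \<open>k\<close>, given by conditioning on the first step.\<close>

primrec avoid :: "'v \<Rightarrow> nat \<Rightarrow> 'v \<Rightarrow> real" where
  "avoid y 0 x = (if x = y then 0 else 1)"
| "avoid y (Suc k) x = (if x = y then 0 else (\<Sum>e\<in>inc x. avoid y k (opp x e)) / deg x)"

lemma avoid_target [simp]: "avoid y k y = 0"
  by (cases k) auto

lemma avoid_bounds: "x \<in> verts G \<Longrightarrow> 0 \<le> avoid y k x \<and> avoid y k x \<le> 1"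
proof (induction k arbitrary: x)
  case (Suc k)
  have "(\<Sum>e\<in>inc x. avoid y k (opp x e)) \<le> (\<Sum>e\<in>inc x. 1)"
    using Suc.IH opp_verts by (intro sum_mono) auto
  moreover have "0 \<le> (\<Sum>e\<in>inc x. avoid y k (opp x e))"
    using Suc.IH opp_verts by (intro sum_nonneg) auto
  ultimately show ?case using deg_pos[OF Suc.prems] by (simp add: vdegree_def)
qed auto

lemma avoid_antimono: "x \<in> verts G \<Longrightarrow> avoid y (Suc k) x \<le> avoid y k x"
proof (induction k arbitrary: x)
  case 0
  then show ?case using avoid_bounds[OF 0, of y "Suc 0"] by (auto simp del: avoid.simps(2))
next
  case (Suc k)
  have "(\<Sum>e\<in>inc x. avoid y (Suc k) (opp x e)) \<le> (\<Sum>e\<in>inc x. avoid y k (opp x e))"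
    using Suc.IH opp_verts by (intro sum_mono) blast
  then show ?case
    unfolding avoid.simps(2)[of y "Suc k" x] avoid.simps(2)[of y k x]
    by (auto intro: divide_right_mono)
qed

text \<open>The probabilities decrease in \<open>k\<close>; their limit takes values in [0, 1],
  vanishes at \<open>y\<close> and is harmonic elsewhere, so \<open>harmonic_off_vanishes\<close>
  applies.\<close>

lemma avoid_tendsto_0:
  assumes null: "null_capacity G y" and y: "y \<in> verts G" and x: "x \<in> verts G"
  shows "(\<lambda>k. avoid y k x) \<longlonglongrightarrow> 0"
proof -
  define u where "u x = lim (\<lambda>k. avoid y k x)" for x
  have lim: "(\<lambda>k. avoid y k x) \<longlonglongrightarrow> u x" if "x \<in> verts G" for x
  proof -
    have "decseq (\<lambda>k. avoid y k x)"
      using avoid_antimono[OF that] by (intro decseq_SucI)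
    then have "convergent (\<lambda>k. avoid y k x)"
      using decseq_convergent[of "\<lambda>k. avoid y k x" 0] avoid_bounds[OF that] unfolding convergent_def by metis
    then show ?thesis by (simp add: u_def convergent_LIMSEQ_iff)
  qed
  have "u x = 0"
  proof (rule harmonic_off_vanishes[OF null y x])
    show "u y = 0" by (simp add: u_def)
  next
    fix x assume x: "x \<in> verts G"
    show "0 \<le> u x \<and> u x \<le> 1"
      using LIMSEQ_le_const[OF lim[OF x], of 0] LIMSEQ_le_const2[OF lim[OF x], of 1] avoid_bounds[OF x]
      by blast
    assume "x \<noteq> y"
    have "(\<lambda>k. \<Sum>e\<in>inc x. avoid y k (opp x e)) \<longlonglongrightarrow> (\<Sum>e\<in>inc x. u (opp x e))"
      by (intro tendsto_sum lim opp_verts)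
    then have "(\<lambda>k. avoid y (Suc k) x) \<longlonglongrightarrow> (\<Sum>e\<in>inc x. u (opp x e)) / deg x"
      using \<open>x \<noteq> y\<close> deg_pos[OF x] by (auto intro!: tendsto_divide)
    moreover have "(\<lambda>k. avoid y (Suc k) x) \<longlonglongrightarrow> u x"
      by (rule LIMSEQ_Suc[OF lim[OF x]])
    ultimately have "u x = (\<Sum>e\<in>inc x. u (opp x e)) / deg x"
      by (blast intro: LIMSEQ_unique)
    then show "lap G u x = 0" using deg_pos[OF x] by (simp add: lap_eq[OF x] field_simps)
  qed
  then show ?thesis using lim[OF x] by simp
qed

end

context srw
begin

text \<open>Markov property at time \<open>t\<close>: the past is recorded by \<open>occ\<close>,
  the avoidance of \<open>y\<close> from then on by \<open>avoid\<close>.\<close>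

lemma prob_avoid_from:
  fixes t :: nat and y :: 'v
  defines "B \<equiv> \<lambda>r. if r < t then UNIV else - {y}"
  shows "prob {\<omega> \<in> space M. \<forall>r\<le>t + k. W r \<omega> \<in> B r}
    = (\<Sum>x\<in>reach z t. deg x * occ z B t x * avoid y k x)"
proof -
  \<comment> \<open>The sum does not depend on \<open>j\<close>: having survived to time
    \<open>t + j\<close>, the walk must avoid \<open>y\<close> for \<open>k - j\<close> further
    steps. Taking \<open>j = k\<close> yields the probability.\<close>
  have "(\<Sum>x\<in>reach z (t + j). deg x * occ z B (t + j) x * avoid y (k - j) x)
      = (\<Sum>x\<in>reach z t. deg x * occ z B t x * avoid y k x)" if "j \<le> k" for j
    using that
  proof (induction j)
    case (Suc j)
    have "(\<Sum>x\<in>reach z (Suc (t + j)). deg x * occ z B (Suc (t + j)) x * avoid y (k - Suc j) x)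
        = (\<Sum>x\<in>reach z (t + j). occ z B (t + j) x *
            (\<Sum>e\<in>inc x. indicator (B (Suc (t + j))) (opp x e) * avoid y (k - Suc j) (opp x e)))"
      by (rule occ_step[OF z])
    also have "\<dots> = (\<Sum>x\<in>reach z (t + j). deg x * occ z B (t + j) x * avoid y (k - j) x)"
    proof (rule sum.cong)
      fix x assume "x \<in> reach z (t + j)"
      then have d: "deg x > 0" using reach_verts[OF z] deg_pos by blast
      \<comment> \<open>The indicator excludes only \<open>y\<close>, where \<open>avoid\<close> is
        zero anyway.\<close>
      have "(\<Sum>e\<in>inc x. indicator (B (Suc (t + j))) (opp x e) * avoid y (k - Suc j) (opp x e))
          = (\<Sum>e\<in>inc x. avoid y (k - Suc j) (opp x e))"
        by (intro sum.cong) (auto simp: B_def indicator_def)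
      also have "\<dots> = deg x * avoid y (Suc (k - Suc j)) x" if "x \<noteq> y"
        using that d by simp
      moreover have "Suc (k - Suc j) = k - j" using Suc.prems by simp
      moreover have "occ z B (t + j) y = 0" by (rule occ_outside) (simp add: B_def)
      ultimately show "occ z B (t + j) x *
          (\<Sum>e\<in>inc x. indicator (B (Suc (t + j))) (opp x e) * avoid y (k - Suc j) (opp x e))
        = deg x * occ z B (t + j) x * avoid y (k - j) x"
        by (cases "x = y") auto
    qed simp
    finally show ?case using Suc by simp
  qed simp
  from this[of k] have "(\<Sum>x\<in>reach z t. deg x * occ z B t x * avoid y k x)
      = (\<Sum>x\<in>reach z (t + k). deg x * occ z B (t + k) x * avoid y 0 x)" by simp
  also have "\<dots> = (\<Sum>x\<in>reach z (t + k). deg x * occ z B (t + k) x)"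
    using occ_outside[of y B "t + k" z] by (intro sum.cong) (auto simp: B_def)
  finally show ?thesis by (simp add: prob_stay)
qed

text \<open>The probability of missing \<open>y\<close> from time \<open>t\<close> on is bounded by
  a finite sum over the ball of radius \<open>t\<close>, each term of which tends to 0 as the
  horizon \<open>k\<close> grows.\<close>

lemma AE_visits_infinitely_often:
  assumes null: "null_capacity G y" and y: "y \<in> verts G"
  shows "AE \<omega> in M. \<exists>\<^sub>\<infinity>t. W t \<omega> = y"
proof -
  have "AE \<omega> in M. \<exists>r\<ge>t. W r \<omega> = y" for t
  proof -
    define B where "B = (\<lambda>r. if r < t then UNIV else - {y})"
    define N where "N = {\<omega> \<in> space M. \<forall>r\<ge>t. W r \<omega> \<noteq> y}"
    have N: "N \<in> sets M" unfolding N_def by measurable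
    have "prob N \<le> (\<Sum>x\<in>reach z t. deg x * occ z B t x * avoid y k x)" for k
    proof -
      have "prob N \<le> prob {\<omega> \<in> space M. \<forall>r\<le>t + k. W r \<omega> \<in> B r}"
      proof (rule finite_measure_mono)
        show "N \<subseteq> {\<omega> \<in> space M. \<forall>r\<le>t + k. W r \<omega> \<in> B r}"
          unfolding N_def B_def by (auto simp: not_less)
      qed measurable
      then show ?thesis unfolding B_def prob_avoid_from .
    qed
    moreover have "(\<lambda>k. \<Sum>x\<in>reach z t. deg x * occ z B t x * avoid y k x) \<longlonglongrightarrow> (\<Sum>x\<in>reach z t. deg x * occ z B t x * 0)"
      using avoid_tendsto_0[OF null y] reach_verts[OF z]
      by (intro tendsto_sum tendsto_mult tendsto_const) auto
    ultimately have "prob N \<le> 0"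
      by (intro LIMSEQ_le_const[of _ 0 "prob N"]) auto
    then have "prob N = 0" using measure_nonneg[of M N] by linarith
    then have "AE \<omega> in M. \<omega> \<notin> N" using prob_eq_0[OF N] by simp
    then show ?thesis
    proof (rule AE_mp, intro AE_I2 impI)
      fix \<omega> assume "\<omega> \<in> space M" "\<omega> \<notin> N"
      then show "\<exists>r\<ge>t. W r \<omega> = y" by (auto simp: N_def)
    qed
  qed
  then have "AE \<omega> in M. \<forall>t. \<exists>r\<ge>t. W r \<omega> = y" by (simp add: AE_all_countable)
  then show ?thesis by (simp add: INFM_nat_le)
qed

end

lemma recurrent_if_null_capacity:
  assumes G: "walkable G" and y: "y \<in> verts G" and null: "null_capacity G y"
  shows "recurrent G"
  unfolding recurrent_def
proof (intro conjI ballI allI impI)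
  fix z x and M :: "(nat \<Rightarrow> 'a \<times> 'b) measure" and W X
  assume "z \<in> verts G" "simple_random_walk G z M W X" and x: "x \<in> verts G"
  then interpret srw G z M W X using G by unfold_locales auto
  show "AE \<omega> in M. \<exists>\<^sub>\<infinity>t. W t \<omega> = x"
    by (rule AE_visits_infinitely_often[OF null_capacity_any[OF null y x] x])
qed (fact G)

section \<open>The Green function\<close>

context walkable_graph
begin

abbreviation heat :: "'v \<Rightarrow> nat \<Rightarrow> 'v \<Rightarrow> real" where "heat z \<equiv> occ z (\<lambda>_. UNIV)"

text \<open>Expected number of visits to \<open>x\<close> before time \<open>N\<close>, divided by
  the degree of \<open>x\<close>.\<close>

definition green :: "'v \<Rightarrow> nat \<Rightarrow> 'v \<Rightarrow> real" where
  "green z N x = (\<Sum>n<N. heat z n x)"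

lemma green_0 [simp]: "green z 0 x = 0"
  and green_Suc: "green z (Suc N) x = green z N x + heat z N x"
  by (simp_all add: green_def)

lemma green_nonneg: "0 \<le> green z N x"
  by (simp add: green_def occ_nonneg sum_nonneg)

lemma reach_mono: "n \<le> m \<Longrightarrow> reach z n \<subseteq> reach z m"
  by (rule lift_Suc_mono_le) (simp add: subset_near)

lemma green_eq_0: "x \<notin> reach z N \<Longrightarrow> green z N x = 0"
  unfolding green_def
proof (intro sum.neutral ballI occ_eq_0)
  fix n assume "x \<notin> reach z N" "n \<in> {..<N}"
  then show "x \<notin> reach z n" using reach_mono[of n N z] by auto
qed

text \<open>At \<open>x\<close>, the Laplacian of \<open>heat z N\<close> is \<open>deg x\<close>
  times the drop from time \<open>N\<close> to time \<open>Suc N\<close>, so the sum telescopes to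
  the mass at time 0 minus the mass at time \<open>N\<close>.\<close>

lemma lap_green:
  assumes "x \<in> verts G"
  shows "lap G (green z N) x = (if x = z then 1 else 0) - deg x * heat z N x"
proof (induction N)
  case 0
  then show ?case using deg_pos[OF assms] by (auto simp: lap_def)
next
  case (Suc N)
  have "lap G (green z (Suc N)) x
      = lap G (green z N) x + deg x * heat z N x - (\<Sum>e\<in>inc x. heat z N (opp x e))"
    by (simp add: lap_eq[OF assms] green_Suc sum.distrib algebra_simps)
  also have "(\<Sum>e\<in>inc x. heat z N (opp x e)) = deg x * heat z (Suc N) x"
    using deg_pos[OF assms] by simp
  finally show ?case using Suc by simp
qed

lemma green_recursion:
  assumes "x \<in> verts G"
  shows "deg x * green z (Suc N) x = (if x = z then 1 else 0) + (\<Sum>e\<in>inc x. green z N (opp x e))"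
  using lap_green[OF assms, of z N] by (simp add: lap_eq[OF assms] green_Suc algebra_simps)

text \<open>Green's identity with \<open>g\<close> of the Green function as test function: by
  \<open>lap_green\<close> the Laplacian is at most 1 at \<open>z\<close> and at most 0 elsewhere.
  The identity as \<open>g\<close> bounds the energy of \<open>green\<close> itself, and a bounded
  \<open>g\<close> gives a bound uniform in \<open>N\<close>.\<close>

lemma energy_green:
  assumes z: "z \<in> verts G" and g: "mono g" "g 0 = 0" and A: "finite A" "A \<subseteq> darts G"
  shows "(\<Sum>d\<in>A. grad G (\<lambda>x. g (green z N x)) d * grad G (green z N) d) \<le> 2 * g (green z N z)"
proof -
  let ?S = "reach z N"
  have S: "finite ?S" "?S \<subseteq> verts G" using finite_reach reach_verts z by auto
  have g0: "0 \<le> g (green z N x)" for x using monoD[OF g(1) green_nonneg] g(2) by metis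
  have "(\<Sum>d\<in>A. grad G (\<lambda>x. g (green z N x)) d * grad G (green z N) d)
      \<le> (\<Sum>d\<in>Darts ?S. grad G (\<lambda>x. g (green z N x)) d * grad G (green z N) d)"
  proof (rule sum_le_sum_Darts[OF S A])
    fix d assume "d \<in> darts G" "d \<notin> Darts ?S"
    then show "grad G (\<lambda>x. g (green z N x)) d * grad G (green z N) d = 0"
      by (simp add: grad_alt Darts_def green_eq_0)
  next
    fix d
    show "0 \<le> grad G (\<lambda>x. g (green z N x)) d * grad G (green z N) d"
      unfolding grad_alt
      using monoD[OF g(1), of "green z N (fst d)" "green z N (fst (flip d))"]
        monoD[OF g(1), of "green z N (fst (flip d))" "green z N (fst d)"]
      by (cases "green z N (fst d) \<le> green z N (fst (flip d))")
         (auto intro: mult_nonneg_nonneg mult_nonpos_nonpos)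
  qed
  also have "\<dots> = 2 * (\<Sum>x\<in>?S. g (green z N x) * lap G (green z N) x)"
    by (rule green_identity[OF S]) (simp add: green_eq_0 g(2))
  also have "(\<Sum>x\<in>?S. g (green z N x) * lap G (green z N) x)
      \<le> (\<Sum>x\<in>?S. if x = z then g (green z N z) else 0)"
  proof (rule sum_mono)
    fix x assume "x \<in> ?S"
    then have "lap G (green z N) x \<le> (if x = z then 1 else 0)"
      using lap_green[of x z N] S by (auto simp: occ_nonneg)
    then have "g (green z N x) * lap G (green z N) x \<le> g (green z N x) * (if x = z then 1 else 0)"
      by (intro mult_left_mono g0)
    then show "g (green z N x) * lap G (green z N) x \<le> (if x = z then g (green z N z) else 0)"
      by (auto split: if_splits)
  qed
  also have "\<dots> \<le> g (green z N z)" using S g0 by simp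
  finally show ?thesis by simp
qed

text \<open>The energy of \<open>green z N\<close> is at most twice its value at \<open>z\<close>;
  normalising that value to 1 leaves at most \<open>2 / green z N z\<close>.\<close>

lemma null_capacity_if_green_unbounded:
  assumes z: "z \<in> verts G" and unb: "\<And>C. \<exists>N. green z N z > C"
  shows "null_capacity G z"
  unfolding null_capacity_def
proof (intro allI impI)
  fix \<epsilon> :: real assume e: "\<epsilon> > 0"
  obtain N where N: "green z N z > 2 / \<epsilon>" using unb by blast
  let ?v = "green z N z"
  have v: "?v > 0" using N e by (smt (verit) divide_pos_pos)
  have "energy_le G (green z N) (2 * ?v)"
    unfolding energy_le_def power2_eq_square using energy_green[OF z, of "\<lambda>x. x"] by (auto simp: mono_def)
  from energy_le_mult[OF this, of "1 / ?v"]
  have "energy_le G (\<lambda>x. 1 / ?v * green z N x) \<epsilon>"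
  proof (rule energy_le_mono)
    show "(1 / ?v)\<^sup>2 * (2 * ?v) \<le> \<epsilon>" using N v e by (simp add: power2_eq_square field_simps)
  qed
  moreover have "fin_supp G (\<lambda>x. 1 / ?v * green z N x)"
    unfolding fin_supp_def by (rule finite_subset[OF _ finite_reach[OF z, of N]]) (use green_eq_0 in auto)
  ultimately show "\<exists>F. fin_supp G F \<and> F z = 1 \<and> energy_le G F \<epsilon>"
    using v by (intro exI[of _ "\<lambda>x. 1 / ?v * green z N x"]) auto
qed

text \<open>
  Functions of bounded energy whose gradients live on disjoint sets of edges add up without
  interaction, so the average of \<open>m\<close> of them has energy of order \<open>1 / m\<close>.
\<close>

lemma null_capacity_if_bounded_energy:
  assumes z: "z \<in> verts G" and freq: "\<exists>\<^sub>\<infinity>n. energy_le G (F n) C"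
    and supp: "\<And>n. fin_supp G (F n)" and one: "\<And>x. x \<in> verts G \<Longrightarrow> \<forall>\<^sub>F n in sequentially. F n x = 1"
  shows "null_capacity G z"
proof -
  \<comment> \<open>The set \<open>K\<close> is arbitrary because the induction step needs
    \<open>H\<close> to be constant around the support of the next \<open>F n\<close>.\<close>
  have sums: "\<exists>H. fin_supp G H \<and> (\<forall>x\<in>K. H x = real m) \<and> energy_le G H (real m * C)"
    if "finite K" "K \<subseteq> verts G" for K m
    using that
  proof (induction m arbitrary: K)
    case 0
    show ?case by (intro exI[of _ "\<lambda>_. 0"]) (auto simp: fin_supp_def energy_le_def grad_def split_def)
  next
    case (Suc m)
    have "\<forall>\<^sub>F n in sequentially. \<forall>x\<in>K. F n x = 1"
      using Suc.prems one by (intro eventually_ball_finite) auto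
    with freq have "\<exists>\<^sub>\<infinity>n. energy_le G (F n) C \<and> (\<forall>x\<in>K. F n x = 1)"
      unfolding cofinite_eq_sequentially by (rule frequently_eventually_frequently)
    then obtain n where n: "energy_le G (F n) C" "\<And>x. x \<in> K \<Longrightarrow> F n x = 1"
      by (auto dest: INFM_EX)
    define S where "S = {x \<in> verts G. F n x \<noteq> 0}"
    have S: "finite S" "S \<subseteq> verts G" using supp[of n] by (auto simp: S_def fin_supp_def)
    have "finite (near S \<union> K)" "near S \<union> K \<subseteq> verts G"
      using near_fin[OF S] near_verts[OF S(2)] Suc.prems by auto
    from Suc.IH[OF this] obtain H where H: "fin_supp G H" "\<And>x. x \<in> near S \<union> K \<Longrightarrow> H x = real m"
      "energy_le G H (real m * C)" by blast
    \<comment> \<open>\<open>F n\<close> varies only on darts with both ends in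
      \<open>near S\<close>, and there \<open>H\<close> is constant.\<close>
    have disj: "grad G H d = 0 \<or> grad G (F n) d = 0" if d: "d \<in> darts G" for d
    proof (cases "d \<in> Darts S")
      case True
      then have "flip d \<in> Darts S" by (auto simp: Darts_def flip_darts flip_flip)
      then have "fst d \<in> near S" "fst (flip d) \<in> near S" using True Darts_near by force+
      then show ?thesis using H(2) by (simp add: grad_alt)
    next
      case False
      then have "F n (fst d) = 0" "F n (fst (flip d)) = 0"
        using d fst_darts flip_darts by (auto simp: Darts_def S_def)
      then show ?thesis by (simp add: grad_alt)
    qed
    have "energy_le G (\<lambda>x. H x + F n x) (real (Suc m) * C)"
      unfolding energy_le_def
    proof (intro allI impI)
      fix A assume A: "finite A" "A \<subseteq> darts G"
      have "(\<Sum>d\<in>A. (grad G (\<lambda>x. H x + F n x) d)\<^sup>2) = (\<Sum>d\<in>A. (grad G H d)\<^sup>2 + (grad G (F n) d)\<^sup>2)"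
      proof (rule sum.cong)
        fix d assume "d \<in> A"
        then have "grad G H d = 0 \<or> grad G (F n) d = 0" using A disj by blast
        moreover have "grad G (\<lambda>x. H x + F n x) d = grad G H d + grad G (F n) d"
          by (simp add: grad_alt)
        ultimately show "(grad G (\<lambda>x. H x + F n x) d)\<^sup>2 = (grad G H d)\<^sup>2 + (grad G (F n) d)\<^sup>2" by auto
      qed simp
      also have "\<dots> \<le> real m * C + C"
        unfolding sum.distrib using energy_leD[OF H(3) A] energy_leD[OF n(1) A] by (rule add_mono)
      finally show "(\<Sum>d\<in>A. (grad G (\<lambda>x. H x + F n x) d)\<^sup>2) \<le> real (Suc m) * C"
        by (simp add: algebra_simps)
    qed
    moreover have "fin_supp G (\<lambda>x. H x + F n x)"
      using H(1) S(1) unfolding fin_supp_def S_def by (rule finite_subset[rotated, OF finite_UnI]) auto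
    ultimately show ?case using H(2) n(2) by (intro exI[of _ "\<lambda>x. H x + F n x"]) auto
  qed
  show ?thesis unfolding null_capacity_def
  proof (intro allI impI)
    fix \<epsilon> :: real assume e: "\<epsilon> > 0"
    obtain m :: nat where m: "real m > max 1 (C / \<epsilon>)" using reals_Archimedean2 by blast
    obtain H where H: "fin_supp G H" "H z = real m" "energy_le G H (real m * C)"
      using sums[of "{z}" m] z by auto
    have "(1 / real m)\<^sup>2 * (real m * C) \<le> \<epsilon>"
      using m e by (simp add: power2_eq_square field_simps)
    then have "energy_le G (\<lambda>x. 1 / real m * H x) \<epsilon>"
      using energy_le_mult[OF H(3), of "1 / real m"] by (rule energy_le_mono[rotated])
    moreover have "fin_supp G (\<lambda>x. 1 / real m * H x)"
      using H(1) unfolding fin_supp_def by (rule finite_subset[rotated]) auto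
    ultimately show "\<exists>F. fin_supp G F \<and> F z = 1 \<and> energy_le G F \<epsilon>"
      using H(2) m by (intro exI[of _ "\<lambda>x. 1 / real m * H x"]) auto
  qed
qed

end

section \<open>The potential of a transient graph and its truncations\<close>

definition cutoff :: "real \<Rightarrow> real \<Rightarrow> real" where
  "cutoff \<delta> a = min 1 (max 0 (2 * a / \<delta> - 1))"

text \<open>By symmetry let \<open>b \<le> a\<close>. For \<open>a \<le> 2 * \<delta>\<close> the
  slope \<open>2 / \<delta>\<close> suffices, since then \<open>a + b \<le> 4 * \<delta>\<close>.
  For larger \<open>a\<close>, either both values are cut off at 1, or \<open>b < \<delta>\<close>
  and \<open>a - b\<close> is comparable to \<open>a + b\<close>.\<close>

lemma cutoff_gradient_le:
  assumes "\<delta> > 0" "0 \<le> a" "0 \<le> b"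
  shows "(a + b) * (cutoff \<delta> a - cutoff \<delta> b)\<^sup>2 \<le> 8 * ((cutoff \<delta> a - cutoff \<delta> b) * (a - b))"
proof -
  have main: "(a + b) * (cutoff \<delta> a - cutoff \<delta> b)\<^sup>2 \<le> 8 * ((cutoff \<delta> a - cutoff \<delta> b) * (a - b))"
    if "0 \<le> b" "b \<le> a" for a b
  proof -
    define D where "D = cutoff \<delta> a - cutoff \<delta> b"
    have "2 * b / \<delta> \<le> 2 * a / \<delta>" using that assms(1) by (simp add: divide_right_mono)
    then have D0: "0 \<le> D" "D \<le> 1" "D \<le> 2 * a / \<delta> - 2 * b / \<delta>"
      by (auto simp: D_def cutoff_def min_def max_def)
    have "(a + b) * D \<le> 8 * (a - b)"
    proof (cases "a \<le> 2 * \<delta>")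
      case True
      have "(a + b) * D \<le> 4 * \<delta> * (2 * a / \<delta> - 2 * b / \<delta>)"
        using True that D0 assms(1) by (intro mult_mono) auto
      also have "\<dots> = 8 * (a - b)" using assms(1) by (simp add: field_simps)
      finally show ?thesis .
    next
      case False
      show ?thesis
      proof (cases "b \<ge> \<delta>")
        case True
        then have "2 * a / \<delta> \<ge> 2" "2 * b / \<delta> \<ge> 2" using that assms(1) by (auto simp: field_simps)
        then have "D = 0" by (simp add: D_def cutoff_def)
        then show ?thesis using that by simp
      next
        case b: False
        have "(a + b) * D \<le> (a + b) * 1" using that D0 by (intro mult_left_mono) auto
        also have "\<dots> \<le> 8 * (a - b)" using b False that by simp
        finally show ?thesis .
      qed
    qed
    then have "(a + b) * D * D \<le> 8 * (a - b) * D" using D0 by (intro mult_right_mono)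
    then have "(a + b) * D\<^sup>2 \<le> 8 * (D * (a - b))" by (simp add: power2_eq_square algebra_simps)
    then show ?thesis unfolding D_def .
  qed
  show ?thesis
  proof (cases "b \<le> a")
    case False
    then show ?thesis using main[OF assms(2), of b] by (simp add: power2_commute[of "cutoff \<delta> a"] algebra_simps)
  qed (use main assms in blast)
qed

text \<open>Transience takes the form of a bounded Green function at \<open>z\<close>, the exact
  alternative to the hypothesis of \<open>null_capacity_if_green_unbounded\<close>.\<close>

locale transient_graph = walkable_graph G for G :: "('v, 'e) multigraph" +
  fixes z :: 'v
  assumes start: "z \<in> verts G" and green_bounded: "\<exists>C. \<forall>N. green z N z \<le> C"
begin

definition pot :: "'v \<Rightarrow> real" where
  "pot x = (\<Sum>n. heat z n x)"

text \<open>Boundedness of the partial sums spreads along edges: by \<open>green_recursion\<close>,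
  the value at a neighbour of \<open>x\<close> is at most \<open>deg x\<close> times the next
  partial sum at \<open>x\<close>.\<close>

lemma summable_heat:
  assumes "x \<in> verts G" shows "summable (\<lambda>n. heat z n x)"
proof -
  have "\<exists>C. \<forall>N. green z N x \<le> C"
    using start assms
  proof (induction rule: connected_induct)
    case (step x e)
    then obtain C where C: "\<And>N. green z N x \<le> C" by blast
    have "green z N (opp x e) \<le> deg x * C" for N
    proof -
      have "green z N (opp x e) \<le> (\<Sum>e\<in>inc x. green z N (opp x e))"
        using member_le_sum[of e "inc x" "\<lambda>e. green z N (opp x e)"] step.hyps finite_inc green_nonneg
        by auto
      also have "\<dots> \<le> deg x * green z (Suc N) x"
        using green_recursion[OF step.hyps(1), of z N] by (auto split: if_splits)
      also have "\<dots> \<le> deg x * C" using C by (intro mult_left_mono) auto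
      finally show ?thesis .
    qed
    then show ?case by blast
  qed (use green_bounded in blast)
  then obtain C where C: "\<And>N. green z N x \<le> C" by blast
  have "(\<Sum>i\<le>N. heat z i x) \<le> C" for N
    using C[of "Suc N"] by (simp add: green_def lessThan_Suc_atMost)
  then show ?thesis by (rule bounded_imp_summable[OF occ_nonneg])
qed

lemma green_tendsto_pot: "x \<in> verts G \<Longrightarrow> (\<lambda>N. green z N x) \<longlonglongrightarrow> pot x"
  unfolding green_def pot_def by (rule summable_LIMSEQ[OF summable_heat])

lemma pot_nonneg: "x \<in> verts G \<Longrightarrow> 0 \<le> pot x"
  unfolding pot_def by (intro suminf_nonneg summable_heat occ_nonneg)

lemma pot_recursion:
  assumes x: "x \<in> verts G"
  shows "deg x * pot x = (if x = z then 1 else 0) + (\<Sum>e\<in>inc x. pot (opp x e))"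
proof (rule LIMSEQ_unique)
  show "(\<lambda>N. deg x * green z (Suc N) x) \<longlonglongrightarrow> deg x * pot x"
    by (intro tendsto_mult tendsto_const LIMSEQ_Suc green_tendsto_pot x)
  show "(\<lambda>N. deg x * green z (Suc N) x) \<longlonglongrightarrow> (if x = z then 1 else 0) + (\<Sum>e\<in>inc x. pot (opp x e))"
    unfolding green_recursion[OF x]
    by (intro tendsto_add tendsto_const tendsto_sum green_tendsto_pot opp_verts)
qed

lemma pot_superharmonic: "x \<in> verts G \<Longrightarrow> (\<Sum>e\<in>inc x. pot (opp x e)) \<le> deg x * pot x"
  using pot_recursion[of x] by (auto split: if_splits)

text \<open>Positivity spreads along edges by superharmonicity at the new vertex. It ensures that
  every vertex eventually exceeds a threshold tending to 0.\<close>

lemma pot_pos: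
  assumes "x \<in> verts G" shows "0 < pot x"
  using start assms
proof (induction rule: connected_induct)
  case base
  have "0 \<le> (\<Sum>e\<in>inc z. pot (opp z e))" by (intro sum_nonneg pot_nonneg opp_verts)
  then have "0 < deg z * pot z" using pot_recursion[OF start] by simp
  then show ?case using deg_pos[OF start] by (simp add: zero_less_mult_iff)
next
  case (step x e)
  have e: "e \<in> inc (opp x e)" "opp (opp x e) e = x" using inc_opp opp_opp step by auto
  have "pot x \<le> (\<Sum>e'\<in>inc (opp x e). pot (opp (opp x e) e'))"
    using member_le_sum[of e "inc (opp x e)" "\<lambda>e'. pot (opp (opp x e) e')"] e
      finite_inc[OF opp_verts[OF step.hyps(2)]] by (auto intro: pot_nonneg opp_verts)
  also have "\<dots> \<le> deg (opp x e) * pot (opp x e)"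
    by (rule pot_superharmonic[OF opp_verts[OF step.hyps(2)]])
  finally have "0 < deg (opp x e) * pot (opp x e)" using step.IH by linarith
  then show ?case using deg_pos[OF opp_verts[OF step.hyps(2)]] by (simp add: zero_less_mult_iff)
qed

text \<open>The bound 2 of \<open>energy_green\<close> for \<open>cutoff\<close> survives the limit
  in \<open>N\<close> because \<open>A\<close> is finite and \<open>cutoff\<close> is continuous;
  \<open>cutoff_gradient_le\<close> contributes the factor 8. The weights are those that bound
  crossing probabilities in \<open>emeasure_edge_crossed\<close>.\<close>

lemma energy_cutoff:
  assumes d: "\<delta> > 0" and A: "finite A" "A \<subseteq> darts G"
  shows "(\<Sum>d\<in>A. (pot (fst d) + pot (fst (flip d))) * (grad G (\<lambda>x. cutoff \<delta> (pot x)) d)\<^sup>2) \<le> 16"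
proof -
  have V: "fst d \<in> verts G" "fst (flip d) \<in> verts G" if "d \<in> A" for d
    using that A by (auto simp: fst_darts flip_darts)
  have mono: "mono (cutoff \<delta>)"
    by (rule monoI) (use d in \<open>auto simp: cutoff_def min_def max_def divide_right_mono not_le field_simps\<close>)
  have zero: "cutoff \<delta> 0 = 0" by (simp add: cutoff_def)
  have le1: "cutoff \<delta> a \<le> 1" for a by (simp add: cutoff_def)
  have "(\<Sum>d\<in>A. grad G (\<lambda>x. cutoff \<delta> (pot x)) d * grad G pot d) \<le> 2"
  proof (rule LIMSEQ_le_const2)
    show "(\<lambda>N. \<Sum>d\<in>A. grad G (\<lambda>x. cutoff \<delta> (green z N x)) d * grad G (green z N) d)
        \<longlonglongrightarrow> (\<Sum>d\<in>A. grad G (\<lambda>x. cutoff \<delta> (pot x)) d * grad G pot d)"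
      unfolding grad_alt cutoff_def using d
      by (intro tendsto_sum tendsto_mult tendsto_diff tendsto_min tendsto_max tendsto_const
          tendsto_divide green_tendsto_pot V) auto
    have "(\<Sum>d\<in>A. grad G (\<lambda>x. cutoff \<delta> (green z N x)) d * grad G (green z N) d) \<le> 2" for N
      using energy_green[OF start mono zero A, of N] le1[of "green z N z"] by linarith
    then show "\<exists>N. \<forall>n\<ge>N. (\<Sum>d\<in>A. grad G (\<lambda>x. cutoff \<delta> (green z n x)) d * grad G (green z n) d) \<le> 2"
      by blast
  qed
  moreover have "(\<Sum>d\<in>A. (pot (fst d) + pot (fst (flip d))) * (grad G (\<lambda>x. cutoff \<delta> (pot x)) d)\<^sup>2)
      \<le> (\<Sum>d\<in>A. 8 * (grad G (\<lambda>x. cutoff \<delta> (pot x)) d * grad G pot d))"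
    unfolding grad_alt by (intro sum_mono cutoff_gradient_le d pot_nonneg V)
  ultimately show ?thesis unfolding sum_distrib_left[symmetric] by linarith
qed

text \<open>Chapman-Kolmogorov combined with reversibility: \<open>occ_step\<close> moves one time
  step after another from the first factor to the second.\<close>

lemma heat_pairing:
  "(\<Sum>x\<in>reach z t. deg x * heat z t x * heat z n x) = heat z (t + n) z"
proof (induction t arbitrary: n)
  case 0
  then show ?case using deg_pos[OF start] by simp
next
  case (Suc t)
  have "(\<Sum>x\<in>reach z (Suc t). deg x * heat z (Suc t) x * heat z n x)
      = (\<Sum>x\<in>reach z t. heat z t x * (\<Sum>e\<in>inc x. indicator UNIV (opp x e) * heat z n (opp x e)))"
    by (rule occ_step[OF start])
  also have "\<dots> = (\<Sum>x\<in>reach z t. deg x * heat z t x * heat z (Suc n) x)"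
  proof (rule sum.cong)
    fix x assume "x \<in> reach z t"
    then have "deg x > 0" using reach_verts[OF start] deg_pos by blast
    then show "heat z t x * (\<Sum>e\<in>inc x. indicator UNIV (opp x e) * heat z n (opp x e))
        = deg x * heat z t x * heat z (Suc n) x" by simp
  qed simp
  finally show ?case using Suc[of "Suc n"] by simp
qed

text \<open>By \<open>heat_pairing\<close>, the mean of \<open>pot (W t)\<close> is the tail from
  time \<open>t\<close> on of the series defining \<open>pot z\<close>.\<close>

lemma mean_pot_tendsto_0:
  "(\<lambda>t. \<Sum>x\<in>reach z t. deg x * heat z t x * pot x) \<longlonglongrightarrow> 0"
proof -
  have "(\<Sum>x\<in>reach z t. deg x * heat z t x * pot x) = pot z - green z t z" for t
  proof (rule LIMSEQ_unique)
    show "(\<lambda>N. \<Sum>x\<in>reach z t. deg x * heat z t x * green z N x)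
        \<longlonglongrightarrow> (\<Sum>x\<in>reach z t. deg x * heat z t x * pot x)"
      using reach_verts[OF start] by (intro tendsto_sum tendsto_mult tendsto_const green_tendsto_pot) auto
    have "(\<Sum>x\<in>reach z t. deg x * heat z t x * green z N x) = green z (N + t) z - green z t z" for N
    proof (induction N)
      case (Suc N)
      then show ?case
        using heat_pairing[of t N] by (simp add: green_Suc distrib_left sum.distrib add.commute)
    qed simp
    then show "(\<lambda>N. \<Sum>x\<in>reach z t. deg x * heat z t x * green z N x) \<longlonglongrightarrow> pot z - green z t z"
      by (simp only:) (intro tendsto_diff tendsto_const LIMSEQ_ignore_initial_segment green_tendsto_pot start)
  qed
  moreover have "(\<lambda>t. pot z - green z t z) \<longlonglongrightarrow> pot z - pot z"
    by (intro tendsto_diff tendsto_const green_tendsto_pot start)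
  ultimately show ?thesis by simp
qed

end

section \<open>The potential along the walk, and crossing probabilities\<close>

locale transient_srw = srw G z M W X + transient_graph G z
  for G :: "('v, 'e) multigraph" and z :: 'v and M :: "'w measure"
    and W :: "nat \<Rightarrow> 'w \<Rightarrow> 'v" and X :: "nat \<Rightarrow> 'w \<Rightarrow> 'e"
begin

text \<open>Doob's maximal inequality for the supermartingale \<open>pot (W t)\<close>.\<close>

lemma prob_pot_stays_small:
  assumes l: "\<kappa> > 0"
  defines "m \<equiv> \<lambda>t. \<Sum>x\<in>reach z t. deg x * heat z t x * pot x"
  defines "B \<equiv> \<lambda>t r. if r \<le> t then UNIV else {x. pot x < \<kappa>}"
  shows "1 - m t / \<kappa> \<le> prob {\<omega> \<in> space M. \<forall>r\<le>t + k. W r \<omega> \<in> B t r}"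
proof -
  \<comment> \<open>The mean of \<open>pot - \<kappa>\<close> over paths killed, after time
    \<open>t\<close>, on reaching \<open>pot \<ge> \<kappa>\<close>. Killing drops only nonnegative
    terms, so superharmonicity makes it decrease from time \<open>t\<close> on.\<close>
  let ?\<psi> = "\<lambda>s. \<Sum>x\<in>reach z s. deg x * occ z (B t) s x * (pot x - \<kappa>)"
  have occ_eq: "s \<le> t \<Longrightarrow> occ z (B t) s x = heat z s x" for s x
    by (induction s arbitrary: x) (auto simp: B_def)
  have "(\<Sum>x\<in>reach z t. deg x * heat z t x) = 1"
    using prob_stay[of t "\<lambda>_. UNIV"] by (simp add: prob_space)
  then have base: "?\<psi> t = m t - \<kappa>"
    by (simp add: occ_eq m_def right_diff_distrib sum_subtractf sum_distrib_right[symmetric])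
  have step: "?\<psi> (Suc s) \<le> ?\<psi> s" if "t \<le> s" for s
  proof -
    have "?\<psi> (Suc s) = (\<Sum>x\<in>reach z s. occ z (B t) s x *
        (\<Sum>e\<in>inc x. indicator (B t (Suc s)) (opp x e) * (pot (opp x e) - \<kappa>)))"
      by (rule occ_step[OF z])
    also have "\<dots> \<le> (\<Sum>x\<in>reach z s. deg x * occ z (B t) s x * (pot x - \<kappa>))"
    proof (rule sum_mono)
      fix x assume "x \<in> reach z s"
      then have x: "x \<in> verts G" using reach_verts[OF z] by blast
      have "(\<Sum>e\<in>inc x. indicator (B t (Suc s)) (opp x e) * (pot (opp x e) - \<kappa>))
          \<le> (\<Sum>e\<in>inc x. pot (opp x e) - \<kappa>)"
        using that by (intro sum_mono) (auto simp: B_def indicator_def)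
      also have "\<dots> \<le> deg x * (pot x - \<kappa>)"
        using pot_superharmonic[OF x] by (simp add: sum_subtractf vdegree_def right_diff_distrib)
      finally have "occ z (B t) s x * (\<Sum>e\<in>inc x. indicator (B t (Suc s)) (opp x e) * (pot (opp x e) - \<kappa>))
          \<le> occ z (B t) s x * (deg x * (pot x - \<kappa>))"
        by (rule mult_left_mono) (rule occ_nonneg)
      then show "occ z (B t) s x * (\<Sum>e\<in>inc x. indicator (B t (Suc s)) (opp x e) * (pot (opp x e) - \<kappa>))
          \<le> deg x * occ z (B t) s x * (pot x - \<kappa>)" by (simp add: mult_ac)
    qed
    finally show ?thesis .
  qed
  have "?\<psi> (t + k) \<le> m t - \<kappa>"
  proof (induction k)
    case (Suc k)
    then show ?case using step[of "t + k"] by simp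
  qed (simp add: base)
  \<comment> \<open>Since \<open>pot\<close> is nonnegative, each surviving path contributes at
    least \<open>- \<kappa>\<close>.\<close>
  moreover have "- \<kappa> * prob {\<omega> \<in> space M. \<forall>r\<le>t + k. W r \<omega> \<in> B t r} \<le> ?\<psi> (t + k)"
    unfolding prob_stay sum_distrib_left
  proof (rule sum_mono)
    fix x assume "x \<in> reach z (t + k)"
    then have x: "x \<in> verts G" using reach_verts[OF z] by blast
    have "deg x * occ z (B t) (t + k) x * - \<kappa> \<le> deg x * occ z (B t) (t + k) x * (pot x - \<kappa>)"
      using pot_nonneg[OF x] occ_nonneg by (intro mult_left_mono) auto
    then show "- \<kappa> * (deg x * occ z (B t) (t + k) x) \<le> deg x * occ z (B t) (t + k) x * (pot x - \<kappa>)"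
      by (simp add: mult_ac)
  qed
  ultimately have "\<kappa> - m t \<le> \<kappa> * prob {\<omega> \<in> space M. \<forall>r\<le>t + k. W r \<omega> \<in> B t r}" by linarith
  then show ?thesis using l by (simp add: field_simps)
qed

text \<open>The horizon \<open>k\<close> goes to infinity first, by continuity from above; then
  \<open>t\<close> does, and the mean of the potential disappears from the bound.\<close>

lemma AE_pot_eventually_small:
  assumes l: "\<kappa> > 0"
  shows "AE \<omega> in M. \<forall>\<^sub>F t in sequentially. pot (W t \<omega>) < \<kappa>"
proof -
  define m where "m t = (\<Sum>x\<in>reach z t. deg x * heat z t x * pot x)" for t
  define B where "B t r = (if r \<le> t then UNIV else {x. pot x < \<kappa>})" for t r :: nat
  define E where "E t k = {\<omega> \<in> space M. \<forall>r\<le>t + k. W r \<omega> \<in> B t r}" for t k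
  define L where "L = {\<omega> \<in> space M. \<exists>t. \<forall>r>t. W r \<omega> \<in> {x. pot x < \<kappa>}}"
  have sets: "E t k \<in> sets M" for t k unfolding E_def by measurable
  have L: "L \<in> sets M" unfolding L_def by measurable
  have "1 - m t / \<kappa> \<le> prob L" for t
  proof -
    have "decseq (E t)" by (rule decseq_SucI) (auto simp: E_def)
    then have "(\<lambda>k. prob (E t k)) \<longlonglongrightarrow> prob (\<Inter>k. E t k)"
      using sets by (intro finite_Lim_measure_decseq) auto
    moreover have "1 - m t / \<kappa> \<le> prob (E t k)" for k
      using prob_pot_stays_small[OF l, of t k] by (simp add: E_def B_def m_def)
    ultimately have "1 - m t / \<kappa> \<le> prob (\<Inter>k. E t k)" by (intro LIMSEQ_le_const) auto
    also have "\<dots> \<le> prob L"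
    proof (rule finite_measure_mono[OF _ L], intro subsetI)
      fix \<omega> assume \<omega>: "\<omega> \<in> (\<Inter>k. E t k)"
      have "pot (W r \<omega>) < \<kappa>" if "r > t" for r
        using \<omega> that by (auto simp: E_def B_def dest!: spec[of _ r])
      then show "\<omega> \<in> L" using \<omega> by (auto simp: L_def E_def)
    qed
    finally show ?thesis .
  qed
  moreover have "(\<lambda>t. 1 - m t / \<kappa>) \<longlonglongrightarrow> 1 - 0 / \<kappa>"
    unfolding m_def using l by (intro tendsto_diff tendsto_divide mean_pot_tendsto_0 tendsto_const) auto
  ultimately have "1 \<le> prob L" by (intro LIMSEQ_le_const2[of _ 1]) auto
  then have "prob L = 1" using prob_le_1[of L] by linarith
  then have "AE \<omega> in M. \<omega> \<in> L" using prob_eq_1[OF L] by simp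
  then show ?thesis
  proof (rule AE_mp, intro AE_I2 impI)
    fix \<omega> assume "\<omega> \<in> L"
    then obtain t where "\<forall>r>t. pot (W r \<omega>) < \<kappa>" by (auto simp: L_def)
    then show "\<forall>\<^sub>F t in sequentially. pot (W t \<omega>) < \<kappa>"
      unfolding eventually_sequentially by (intro exI[of _ "Suc t"]) auto
  qed
qed

text \<open>A union bound over all times and both directions of crossing.\<close>

lemma emeasure_edge_crossed:
  assumes a: "a \<in> inc x"
  shows "emeasure M {\<omega> \<in> space M. \<exists>s. X s \<omega> = a} \<le> ennreal (pot x + pot (opp x a))"
proof -
  have V: "x \<in> verts G" "opp x a \<in> verts G" using inc_verts[OF a] opp_verts[OF a] by auto
  have le: "emeasure M {\<omega> \<in> space M. X s \<omega> = a} \<le> ennreal (heat z s x + heat z s (opp x a))" for s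
  proof -
    have "emeasure M {\<omega> \<in> space M. X s \<omega> = a}
        \<le> emeasure M ({\<omega> \<in> space M. W s \<omega> = x \<and> X s \<omega> = a} \<union>
            {\<omega> \<in> space M. W s \<omega> = opp x a \<and> X s \<omega> = a})"
    proof (rule emeasure_mono_AE)
      show "AE \<omega> in M. \<omega> \<in> {\<omega> \<in> space M. X s \<omega> = a} \<longrightarrow>
          \<omega> \<in> {\<omega> \<in> space M. W s \<omega> = x \<and> X s \<omega> = a} \<union> {\<omega> \<in> space M. W s \<omega> = opp x a \<and> X s \<omega> = a}"
        using AE_step
      proof eventually_elim
        case (elim \<omega>)
        then have "X s \<omega> \<in> inc (W s \<omega>)" by blast
        then show ?case using ends_opp[OF a] by (auto simp: incident_def)
      qed
    qed measurable
    also have "\<dots> \<le> emeasure M {\<omega> \<in> space M. W s \<omega> = x \<and> X s \<omega> = a}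
        + emeasure M {\<omega> \<in> space M. W s \<omega> = opp x a \<and> X s \<omega> = a}"
      by (rule emeasure_subadditive) measurable
    also have "\<dots> = ennreal (heat z s x + heat z s (opp x a))"
      using prob_cross[OF a, of s] prob_cross[OF inc_opp[OF a], of s]
      by (simp add: emeasure_eq_measure occ_nonneg)
    finally show ?thesis .
  qed
  have "{\<omega> \<in> space M. \<exists>s. X s \<omega> = a} = (\<Union>s. {\<omega> \<in> space M. X s \<omega> = a})" by auto
  then have "emeasure M {\<omega> \<in> space M. \<exists>s. X s \<omega> = a} \<le> (\<Sum>s. emeasure M {\<omega> \<in> space M. X s \<omega> = a})"
    by (simp only:) (rule emeasure_subadditive_countably, auto)
  also have "\<dots> \<le> (\<Sum>s. ennreal (heat z s x + heat z s (opp x a)))"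
    by (rule suminf_le) (use le in auto)
  also have "\<dots> = ennreal (\<Sum>s. heat z s x + heat z s (opp x a))"
    by (rule suminf_ennreal2) (use summable_heat V occ_nonneg in \<open>auto intro: summable_add\<close>)
  also have "(\<Sum>s. heat z s x + heat z s (opp x a)) = pot x + pot (opp x a)"
    unfolding pot_def by (rule suminf_add[symmetric]; rule summable_heat; fact V)
  finally show ?thesis .
qed

end

text \<open>Fatou's lemma: the full sums have integral at most \<open>c\<close>, so their liminf is
  almost surely finite. This bounds them for infinitely many \<open>n\<close> only, which is all
  that \<open>null_capacity_if_bounded_energy\<close> asks for.\<close>

lemma AE_infinitely_often_bounded_sums:
  fixes f :: "nat \<Rightarrow> 'i \<Rightarrow> 'w \<Rightarrow> real"
  assumes I: "countable I" and meas: "\<And>n i. i \<in> I \<Longrightarrow> f n i \<in> borel_measurable M"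
    and nonneg: "\<And>n i \<omega>. i \<in> I \<Longrightarrow> 0 \<le> f n i \<omega>"
    and le: "\<And>n i. i \<in> I \<Longrightarrow> (\<integral>\<^sup>+\<omega>. ennreal (f n i \<omega>) \<partial>M) \<le> ennreal (p n i)"
    and p: "\<And>n i. i \<in> I \<Longrightarrow> 0 \<le> p n i"
    and bound: "\<And>n A. finite A \<Longrightarrow> A \<subseteq> I \<Longrightarrow> (\<Sum>i\<in>A. p n i) \<le> c"
  shows "AE \<omega> in M. \<exists>C. \<exists>\<^sub>\<infinity>n. \<forall>A. finite A \<longrightarrow> A \<subseteq> I \<longrightarrow> (\<Sum>i\<in>A. f n i \<omega>) \<le> C"
proof -
  \<comment> \<open>Finite sets increasing to \<open>I\<close>, so that monotone convergence
    computes the integral of the full sum.\<close>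
  define A where "A m = {i \<in> I. to_nat_on I i < m}" for m
  have A: "finite (A m)" "A m \<subseteq> I" for m
  proof -
    show "A m \<subseteq> I" by (auto simp: A_def)
    have "finite (to_nat_on I ` A m)"
      by (rule finite_subset[of _ "{..<m}"]) (auto simp: A_def)
    moreover have "inj_on (to_nat_on I) (A m)"
      using inj_on_to_nat_on[OF I] \<open>A m \<subseteq> I\<close> by (rule inj_on_subset)
    ultimately show "finite (A m)" by (rule finite_imageD)
  qed
  have A_mono: "m \<le> m' \<Longrightarrow> A m \<subseteq> A m'" for m m' by (auto simp: A_def)
  have A_cover: "\<exists>m. F \<subseteq> A m" if "finite F" "F \<subseteq> I" for F
  proof -
    have "finite (to_nat_on I ` F)" using that by simp
    then obtain m where "\<forall>i\<in>to_nat_on I ` F. i < m" using finite_nat_set_iff_bounded by auto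
    then show ?thesis using that by (intro exI[of _ m]) (auto simp: A_def)
  qed
  define S where "S n \<omega> = (SUP m. ennreal (\<Sum>i\<in>A m. f n i \<omega>))" for n \<omega>
  have meas_sum: "(\<lambda>\<omega>. ennreal (\<Sum>i\<in>A m. f n i \<omega>)) \<in> borel_measurable M" for n m
    using A meas by (intro measurable_compose[OF _ measurable_ennreal] borel_measurable_sum) blast
  then have S_meas: "S n \<in> borel_measurable M" for n
    unfolding S_def by (intro borel_measurable_SUP) auto
  have S_int: "(\<integral>\<^sup>+\<omega>. S n \<omega> \<partial>M) \<le> ennreal c" for n
  proof -
    have "(\<integral>\<^sup>+\<omega>. S n \<omega> \<partial>M) = (SUP m. \<integral>\<^sup>+\<omega>. ennreal (\<Sum>i\<in>A m. f n i \<omega>) \<partial>M)"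
      unfolding S_def
    proof (rule nn_integral_monotone_convergence_SUP)
      show "incseq (\<lambda>m \<omega>. ennreal (\<Sum>i\<in>A m. f n i \<omega>))"
      proof (intro incseq_SucI le_funI ennreal_leI sum_mono2)
        fix m i \<omega> assume "i \<in> A (Suc m) - A m"
        then show "0 \<le> f n i \<omega>" using A(2)[of "Suc m"] by (intro nonneg) auto
      qed (rule A(1), rule A_mono, simp)
    qed (rule meas_sum)
    also have "\<dots> \<le> ennreal c"
    proof (rule SUP_least)
      fix m
      have "(\<integral>\<^sup>+\<omega>. ennreal (\<Sum>i\<in>A m. f n i \<omega>) \<partial>M) = (\<integral>\<^sup>+\<omega>. (\<Sum>i\<in>A m. ennreal (f n i \<omega>)) \<partial>M)"
        using A(2) nonneg by (intro nn_integral_cong sum_ennreal[symmetric]) blast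
      also have "\<dots> = (\<Sum>i\<in>A m. \<integral>\<^sup>+\<omega>. ennreal (f n i \<omega>) \<partial>M)"
        using A(2) meas by (intro nn_integral_sum measurable_compose[OF _ measurable_ennreal]) blast
      also have "\<dots> \<le> (\<Sum>i\<in>A m. ennreal (p n i))" using A(2) le by (intro sum_mono) blast
      also have "\<dots> = ennreal (\<Sum>i\<in>A m. p n i)" using A(2) p by (intro sum_ennreal) blast
      also have "\<dots> \<le> ennreal c" by (intro ennreal_leI bound A)
      finally show "(\<integral>\<^sup>+\<omega>. ennreal (\<Sum>i\<in>A m. f n i \<omega>) \<partial>M) \<le> ennreal c" .
    qed
    finally show ?thesis .
  qed
  have "(\<integral>\<^sup>+\<omega>. liminf (\<lambda>n. S n \<omega>) \<partial>M) \<le> liminf (\<lambda>n. \<integral>\<^sup>+\<omega>. S n \<omega> \<partial>M)"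
    by (rule nn_integral_liminf[OF S_meas])
  also have "\<dots> \<le> liminf (\<lambda>n. ennreal c)" by (rule Liminf_mono) (use S_int in auto)
  also have "\<dots> = ennreal c" by (simp add: Liminf_const)
  finally have "(\<integral>\<^sup>+\<omega>. liminf (\<lambda>n. S n \<omega>) \<partial>M) \<noteq> \<infinity>" by (auto simp: top_unique)
  then have "AE \<omega> in M. liminf (\<lambda>n. S n \<omega>) \<noteq> \<infinity>"
    by (rule nn_integral_noteq_infinite[rotated]) (intro borel_measurable_liminf S_meas)
  then show ?thesis
  proof (rule AE_mp, intro AE_I2 impI)
    fix \<omega> assume "\<omega> \<in> space M" "liminf (\<lambda>n. S n \<omega>) \<noteq> \<infinity>"
    then obtain C' where "C' \<ge> 0" "liminf (\<lambda>n. S n \<omega>) = ennreal C'"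
      by (cases "liminf (\<lambda>n. S n \<omega>)") auto
    \<comment> \<open>A constant strictly above the liminf is undershot infinitely often.\<close>
    then obtain C where C: "C \<ge> 0" "liminf (\<lambda>n. S n \<omega>) < ennreal C"
      by (auto intro!: that[of "C' + 1"] simp: ennreal_less_iff)
    have "\<exists>\<^sub>\<infinity>n. S n \<omega> \<le> ennreal C"
    proof (rule ccontr)
      assume "\<not> (\<exists>\<^sub>\<infinity>n. S n \<omega> \<le> ennreal C)"
      then have "\<forall>\<^sub>F n in sequentially. ennreal C \<le> S n \<omega>"
        unfolding cofinite_eq_sequentially not_frequently by (auto elim: eventually_mono)
      then have "ennreal C \<le> liminf (\<lambda>n. S n \<omega>)" by (rule Liminf_bounded)
      then show False using C by simp
    qed
    then have "\<exists>\<^sub>\<infinity>n. \<forall>F. finite F \<longrightarrow> F \<subseteq> I \<longrightarrow> (\<Sum>i\<in>F. f n i \<omega>) \<le> C"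
    proof (rule frequently_elim1, intro allI impI)
      fix n F assume n: "S n \<omega> \<le> ennreal C" and F: "finite F" "F \<subseteq> I"
      obtain m where m: "F \<subseteq> A m" using A_cover[OF F] by blast
      have "(\<Sum>i\<in>F. f n i \<omega>) \<le> (\<Sum>i\<in>A m. f n i \<omega>)"
        using A(1) A(2)[of m] m nonneg by (intro sum_mono2) auto
      moreover have "ennreal (\<Sum>i\<in>A m. f n i \<omega>) \<le> ennreal C"
        using n SUP_upper[of m UNIV "\<lambda>m. ennreal (\<Sum>i\<in>A m. f n i \<omega>)"] unfolding S_def by auto
      ultimately show "(\<Sum>i\<in>F. f n i \<omega>) \<le> C" using C(1) by simp
    qed
    then show "\<exists>C. \<exists>\<^sub>\<infinity>n. \<forall>A. finite A \<longrightarrow> A \<subseteq> I \<longrightarrow> (\<Sum>i\<in>A. f n i \<omega>) \<le> C" by blast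
  qed
qed

section \<open>The trace\<close>

lemma PATH_simps [simp]:
  "verts (PATH G W X \<omega>) = range (\<lambda>t. W t \<omega>)"
  "edges (PATH G W X \<omega>) = range (\<lambda>t. X t \<omega>)"
  "ends (PATH G W X \<omega>) = ends G"
  by (simp_all add: PATH_def)

lemma grad_PATH [simp]: "grad (PATH G W X \<omega>) = grad G"
  by (simp add: grad_def other_end_def fun_eq_iff)

lemma darts_PATH: "d \<in> darts (PATH G W X \<omega>) \<longleftrightarrow> snd d \<in> range (\<lambda>t. X t \<omega>) \<and> fst d \<in> ends G (snd d)"
  by (cases d) (simp add: darts_def)

context srw
begin

lemma walkable_PATH:
  assumes \<omega>: "\<omega> \<in> space M" and ends: "\<And>t. ends G (X t \<omega>) = {W t \<omega>, W (Suc t) \<omega>}"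
  shows "walkable (PATH G W X \<omega>)"
  unfolding walkable_def
proof (intro conjI ballI)
  let ?P = "PATH G W X \<omega>"
  show "wf_multigraph ?P"
    unfolding wf_multigraph_def
  proof (intro ballI conjI)
    fix e assume "e \<in> edges ?P"
    then obtain t where t: "e = X t \<omega>" by auto
    show "ends ?P e \<subseteq> verts ?P" using ends t by auto
    show "card (ends ?P e) = 2"
      using walkable X_edges[OF \<omega>, of t] t by (auto simp: wf_multigraph_def walkable_def)
  qed
  show "connected_multigraph ?P"
  proof -
    let ?R = "{(x, y). \<exists>e\<in>edges ?P. ends ?P e = {x, y}}"
    have "(W 0 \<omega>, W t \<omega>) \<in> ?R\<^sup>*" for t
    proof (induction t)
      case (Suc t)
      moreover have "(W t \<omega>, W (Suc t) \<omega>) \<in> ?R" using ends by auto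
      ultimately show ?case by (rule rtrancl_into_rtrancl)
    qed simp
    moreover have "sym ?R" by (auto simp: sym_def insert_commute)
    ultimately have "(W s \<omega>, W t \<omega>) \<in> ?R\<^sup>*" for s t
      by (meson rtrancl_trans sym_rtrancl symD)
    then show ?thesis by (auto simp: connected_multigraph_def)
  qed
  fix v assume "v \<in> verts ?P"
  then obtain t where t: "v = W t \<omega>" by auto
  have "incident ?P v \<subseteq> inc v" using X_edges[OF \<omega>] by (auto simp: incident_def)
  then show fin: "finite (incident ?P v)"
    using finite_inc[OF W_verts[OF \<omega>, of t]] t by (auto intro: finite_subset)
  have "X t \<omega> \<in> incident ?P v" using ends t by (auto simp: incident_def)
  then show "1 \<le> vdegree ?P v" using fin by (auto simp: vdegree_def Suc_le_eq card_gt_0_iff)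
qed

lemma fin_supp_PATH_mono: "\<omega> \<in> space M \<Longrightarrow> fin_supp G F \<Longrightarrow> fin_supp (PATH G W X \<omega>) F"
  using W_verts unfolding fin_supp_def by (elim finite_subset[rotated]) auto

text \<open>Rayleigh monotonicity: the trace has fewer darts and the same gradients.\<close>

lemma energy_le_PATH_mono: "\<omega> \<in> space M \<Longrightarrow> energy_le G F c \<Longrightarrow> energy_le (PATH G W X \<omega>) F c"
  using X_edges by (fastforce simp: energy_le_def darts_PATH darts_def subset_iff)

text \<open>The guard \<open>walkable\<close> in the hypothesis makes the results of
  \<open>walkable_graph\<close> available for the trace when the hypothesis is proved.\<close>

lemma AE_recurrent_PATH:
  assumes "AE \<omega> in M. walkable (PATH G W X \<omega>) \<longrightarrow> null_capacity (PATH G W X \<omega>) (W 0 \<omega>)"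
  shows "AE \<omega> in M. recurrent (PATH G W X \<omega>)"
  using assms AE_ends AE_space
proof eventually_elim
  case (elim \<omega>)
  then have "walkable (PATH G W X \<omega>)" by (intro walkable_PATH) auto
  then show ?case using elim by (intro recurrent_if_null_capacity[of _ "W 0 \<omega>"]) auto
qed

end

context transient_srw
begin

lemma AE_null_capacity_PATH:
  "AE \<omega> in M. walkable (PATH G W X \<omega>) \<longrightarrow> null_capacity (PATH G W X \<omega>) (W 0 \<omega>)"
proof -
  define \<delta> where "\<delta> n = 1 / real (Suc n)" for n
  define F where "F n x = cutoff (\<delta> n) (pot x)" for n x
  \<comment> \<open>The share of the dart \<open>d\<close> in the energy of \<open>F n\<close> on
    the trace; \<open>p n d\<close> will bound its mean.\<close>
  define f where "f n d \<omega> = (if \<exists>s. X s \<omega> = snd d then (grad G (F n) d)\<^sup>2 else 0)" for n d \<omega>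
  define p where "p n d = (pot (fst d) + pot (fst (flip d))) * (grad G (F n) d)\<^sup>2" for n d
  have \<delta>: "\<delta> n > 0" for n by (simp add: \<delta>_def)
  have "darts G \<subseteq> verts G \<times> edges G" by (auto simp: darts_iff inc_verts) (auto simp: incident_def)
  then have countable: "countable (darts G)"
    using countable_verts countable_edges by (auto intro: countable_subset)
  have "AE \<omega> in M. \<exists>C. \<exists>\<^sub>\<infinity>n. \<forall>A. finite A \<longrightarrow> A \<subseteq> darts G \<longrightarrow> (\<Sum>d\<in>A. f n d \<omega>) \<le> C"
  proof (rule AE_infinitely_often_bounded_sums[where p = p and c = 16, OF countable])
    fix n d
    show "f n d \<in> borel_measurable M" unfolding f_def by measurable
    show "0 \<le> f n d \<omega>" for \<omega> by (simp add: f_def)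
    assume d: "d \<in> darts G"
    then have V: "fst d \<in> verts G" "fst (flip d) \<in> verts G" by (auto simp: fst_darts flip_darts)
    then show "0 \<le> p n d" by (auto simp: p_def intro!: mult_nonneg_nonneg add_nonneg_nonneg pot_nonneg)
    have "(\<integral>\<^sup>+\<omega>. ennreal (f n d \<omega>) \<partial>M)
        = (\<integral>\<^sup>+\<omega>. ennreal ((grad G (F n) d)\<^sup>2) * indicator {\<omega> \<in> space M. \<exists>s. X s \<omega> = snd d} \<omega> \<partial>M)"
      by (rule nn_integral_cong) (auto simp: f_def indicator_def)
    also have "\<dots> = ennreal ((grad G (F n) d)\<^sup>2) * emeasure M {\<omega> \<in> space M. \<exists>s. X s \<omega> = snd d}"
      by (rule nn_integral_cmult_indicator) measurable
    also have "\<dots> \<le> ennreal ((grad G (F n) d)\<^sup>2) * ennreal (pot (fst d) + pot (fst (flip d)))"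
      using d emeasure_edge_crossed[of "snd d" "fst d"]
      by (cases d) (auto simp: flip_def darts_iff intro!: mult_left_mono)
    also have "\<dots> = ennreal (p n d)"
      using V by (subst ennreal_mult[symmetric]) (auto simp: p_def mult.commute intro!: add_nonneg_nonneg pot_nonneg)
    finally show "(\<integral>\<^sup>+\<omega>. ennreal (f n d \<omega>) \<partial>M) \<le> ennreal (p n d)" .
  next
    fix n A assume "finite A" "A \<subseteq> darts G"
    then show "(\<Sum>d\<in>A. p n d) \<le> 16" unfolding p_def F_def by (rule energy_cutoff[OF \<delta>])
  qed
  \<comment> \<open>\<open>F n\<close> vanishes where the potential is at most
    \<open>\<delta> n / 2\<close>, so only finitely many positions of the walk meet its
    support.\<close>
  moreover have "AE \<omega> in M. \<forall>n. \<forall>\<^sub>F t in sequentially. pot (W t \<omega>) < \<delta> n / 2"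
    unfolding AE_all_countable by (intro allI AE_pot_eventually_small) (simp add: \<delta>)
  ultimately show ?thesis
    using AE_space
  proof eventually_elim
    case (elim \<omega>)
    show ?case
    proof
      let ?P = "PATH G W X \<omega>"
      assume "walkable ?P"
      then interpret P: walkable_graph ?P by unfold_locales
      obtain C where C: "\<exists>\<^sub>\<infinity>n. \<forall>A. finite A \<longrightarrow> A \<subseteq> darts G \<longrightarrow> (\<Sum>d\<in>A. f n d \<omega>) \<le> C"
        using elim by blast
      show "null_capacity ?P (W 0 \<omega>)"
      proof (rule P.null_capacity_if_bounded_energy[where F = F and C = C])
        show "\<exists>\<^sub>\<infinity>n. energy_le ?P (F n) C"
          using C
        proof (rule frequently_elim1)
          fix n assume n: "\<forall>A. finite A \<longrightarrow> A \<subseteq> darts G \<longrightarrow> (\<Sum>d\<in>A. f n d \<omega>) \<le> C"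
          show "energy_le ?P (F n) C"
            unfolding energy_le_def
          proof (intro allI impI)
            fix A assume A: "finite A" "A \<subseteq> darts ?P"
            have "A \<subseteq> darts G" using A(2) X_edges elim(3) by (force simp: darts_PATH darts_def)
            then have "(\<Sum>d\<in>A. f n d \<omega>) \<le> C" using n A(1) by blast
            also have "(\<Sum>d\<in>A. f n d \<omega>) = (\<Sum>d\<in>A. (grad ?P (F n) d)\<^sup>2)"
            proof (rule sum.cong)
              fix d assume "d \<in> A"
              then have "d \<in> darts ?P" using A(2) by blast
              then have "snd d \<in> range (\<lambda>t. X t \<omega>)" by (simp only: darts_PATH)
              then obtain s where "X s \<omega> = snd d" by (metis imageE)
              then have "\<exists>s. X s \<omega> = snd d" ..
              then show "f n d \<omega> = (grad ?P (F n) d)\<^sup>2" by (simp add: f_def)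
            qed simp
            finally show "(\<Sum>d\<in>A. (grad ?P (F n) d)\<^sup>2) \<le> C" .
          qed
        qed
        show "fin_supp ?P (F n)" for n
        proof -
          obtain T where T: "\<And>t. t \<ge> T \<Longrightarrow> pot (W t \<omega>) < \<delta> n / 2"
            using elim(2) by (auto simp: eventually_sequentially)
          have zero: "F n (W t \<omega>) = 0" if "t \<ge> T" for t
            using T[OF that] \<delta>[of n] by (simp add: F_def cutoff_def field_simps)
          have "{x \<in> verts ?P. F n x \<noteq> 0} \<subseteq> (\<lambda>t. W t \<omega>) ` {..<T}"
          proof (intro subsetI)
            fix x assume "x \<in> {x \<in> verts ?P. F n x \<noteq> 0}"
            then obtain t where t: "x = W t \<omega>" "F n x \<noteq> 0" by auto
            then have "t < T" using zero[of t] by (metis not_less)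
            then show "x \<in> (\<lambda>t. W t \<omega>) ` {..<T}" using t(1) by simp
          qed
          then show ?thesis unfolding fin_supp_def by (rule finite_subset) simp
        qed
        show "\<forall>\<^sub>F n in sequentially. F n x = 1" if "x \<in> verts ?P" for x
        proof -
          \<comment> \<open>Positive potential at \<open>x\<close> means that \<open>x\<close> lies
            above the upper threshold \<open>\<delta> n\<close> for large \<open>n\<close>, where
            \<open>cutoff\<close> equals 1.\<close>
          have "pot x > 0" using that W_verts elim(3) pot_pos by auto
          moreover have "\<delta> \<longlonglongrightarrow> 0" unfolding \<delta>_def using LIMSEQ_inverse_real_of_nat by (simp add: inverse_eq_divide)
          ultimately have "\<forall>\<^sub>F n in sequentially. \<delta> n < pot x" by (rule order_tendstoD(2)[rotated])
          then show ?thesis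
          proof (rule eventually_mono)
            fix n assume "\<delta> n < pot x"
            then have "1 \<le> 2 * pot x / \<delta> n - 1" using \<delta>[of n] by (simp add: field_simps)
            then show "F n x = 1" by (simp add: F_def cutoff_def)
          qed
        qed
      qed simp
    qed
  qed
qed

end

theorem theorem1p1:
  fixes G :: "('v, 'e) multigraph"
    and M :: "'w measure"
    and W :: "nat \<Rightarrow> 'w \<Rightarrow> 'v"
    and X :: "nat \<Rightarrow> 'w \<Rightarrow> 'e"
  assumes "walkable G"
    and "x\<^sub>0 \<in> verts G"
    and "simple_random_walk G x\<^sub>0 M W X"
  shows "AE \<omega> in M. recurrent (PATH G W X \<omega>)"
proof -
  interpret srw G x\<^sub>0 M W X using assms by unfold_locales
  show ?thesis
  proof (rule AE_recurrent_PATH, cases "\<exists>C. \<forall>N. green x\<^sub>0 N x\<^sub>0 \<le> C")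
    case True
    then interpret transient_srw G x\<^sub>0 M W X using assms by unfold_locales
    show "AE \<omega> in M. walkable (PATH G W X \<omega>) \<longrightarrow> null_capacity (PATH G W X \<omega>) (W 0 \<omega>)"
      by (rule AE_null_capacity_PATH)
  next
    case False
    \<comment> \<open>In this case the whole graph has null capacity at the start, and almost every
      trace inherits it through the same test functions.\<close>
    then have null: "null_capacity G x\<^sub>0"
      using assms(2) by (intro null_capacity_if_green_unbounded) (auto simp: not_le)
    show "AE \<omega> in M. walkable (PATH G W X \<omega>) \<longrightarrow> null_capacity (PATH G W X \<omega>) (W 0 \<omega>)"
      using AE_start AE_space
    proof eventually_elim
      case (elim \<omega>)
      then show ?case
        using null fin_supp_PATH_mono energy_le_PATH_mono unfolding null_capacity_def by metis
    qed
  qed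
qed

end
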